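(* Let $(p_n)_{n\ge 2}$ be a sequence of integers with $1\le p_n<n$. For each $n$, let $z_1,\dots,z_{p_n}$ be the $p_n$ eigenvalues of the $p_n\times p_n$ upper-left submatrix of an $n\times n$ Haar-distributed unitary matrix; their joint density (with respect to Lebesgue measure on $\{z\in\mathbb{C}:|z|<1\}^{p_n}$) is $$C\prod_{1\le j<k\le p_n}|z_j-z_k|^2\prod_{j=1}^{p_n}(1-|z_j|^2)^{n-p_n-1},$$ where $C$ is a normalizing constant depending on $n$ and $p_n$. Assume that one of the following two conditions holds: (1) $p_n\to\infty$ and $\frac{p_n}{n}\to 0$ as $n\to\infty$; (2) $\frac{n-p_n}{(\log n)^3}\to\infty$ and $\frac{n-p_n}{n}\to 0$ as $n\to\infty$. Define, for $y>3$, $$a(y)=(\log y)^{1/2}-(\log y)^{-1/2}\log(\sqrt{2\pi}\log y),\qquad b(y)=(\log y)^{-1/2},$$ and, for $n$ large enough, $$c_n=\Big(\frac{p_n-1}{n-1}\Big)^{1/2},\quad a_n=a\Big(\frac{nc_n^2}{1-c_n^2}\Big),\quad b_n=b\Big(\frac{nc_n^2}{1-c_n^2}\Big),$$ $$A_n=c_n+\tfrac12(1-c_n^2)^{1/2}(n-1)^{-1/2}a_n,\qquad B_n=\tfrac12(1-c_n^2)^{1/2}(n-1)^{-1/2}b_n.$$ Then $\big(\max_{1\le j\le p_n}|z_j|-A_n\big)/B_n$ converges weakly, as $n\to\infty$, to the Gumbel distribution $\Lambda(x)=\exp(-e^{-x})$, $x\in\mathbb{R}$.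
   Context: A circular unitary matrix is an $n\times n$ random unitary matrix distributed according to Haar measure on the unitary group $U(n)$. Its truncation is the $p_n\times p_n$ submatrix obtained by deleting the last $n-p_n$ rows and columns. Weak convergence means convergence in distribution, i.e. pointwise convergence of the cumulative distribution functions at every continuity point of the limit. *)

theory Defs
  imports
    "HOL-Probability.Probability"
    "Jordan_Normal_Form.Char_Poly"
    "Jordan_Normal_Form.Schur_Decomposition"
begin

definition unitary_group :: "nat \<Rightarrow> complex mat set" where
  "unitary_group n = {V \<in> carrier_mat n n. mat_adjoint V * V = 1\<^sub>m n \<and> V * mat_adjoint V = 1\<^sub>m n}"

(* The type of matrices carries no topology.  U(n) is given the sigma-algebra
   generated by the matrix entries, i.e. its Borel sigma-algebra as a subspace
   of C^(n*n). Only the sets matter; the measure of this object is irrelevant. *)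
definition unitary_borel :: "nat \<Rightarrow> complex mat measure" where
  "unitary_borel n =
     vimage_algebra (unitary_group n)
       (\<lambda>V. \<lambda>ij\<in>{..<n} \<times> {..<n}. V $$ ij)
       (\<Pi>\<^sub>M ij\<in>{..<n} \<times> {..<n}. (borel :: complex measure))"

(* Left invariance together with total mass 1 characterises normalised Haar
   measure; right invariance follows because U(n) is compact. *)
definition is_haar_unitary :: "nat \<Rightarrow> complex mat measure \<Rightarrow> bool" where
  "is_haar_unitary n \<mu> \<longleftrightarrow>
     prob_space \<mu> \<and> sets \<mu> = sets (unitary_borel n) \<and>
     (\<forall>V\<in>unitary_group n. distr \<mu> (unitary_borel n) (\<lambda>W. V * W) = \<mu>)"

definition haar_unitary_rv :: "'a measure \<Rightarrow> nat \<Rightarrow> ('a \<Rightarrow> complex mat) \<Rightarrow> bool" where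
  "haar_unitary_rv M n U \<longleftrightarrow>
     U \<in> measurable M (unitary_borel n) \<and> is_haar_unitary n (distr M (unitary_borel n) U)"

definition truncation :: "nat \<Rightarrow> complex mat \<Rightarrow> complex mat" where
  "truncation p V = mat p p (\<lambda>(i, j). V $$ (i, j))"

(* z lists the eigenvalues of A, repeated according to algebraic multiplicity,
   over the index set I (in no particular order). *)
definition eigenvalues_of :: "complex mat \<Rightarrow> 'i set \<Rightarrow> ('i \<Rightarrow> complex) \<Rightarrow> bool" where
  "eigenvalues_of A I z \<longleftrightarrow> char_poly A = (\<Prod>j\<in>I. [:- z j, 1:])"

(* Eigenvalues come without a canonical order, so "the eigenvalues have joint
   density f" is a statement about permutation-invariant events only.  It does
   not depend on how the eigenvalues are labelled, and it is implied by f being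
   the density of the labelled vector in the sense of the constant distributed
   (see distributed_imp_unordered_joint_density). *)
definition unordered_joint_density ::
    "'a measure \<Rightarrow> 'i set \<Rightarrow> ('i \<Rightarrow> 'a \<Rightarrow> complex) \<Rightarrow> (('i \<Rightarrow> complex) \<Rightarrow> real) \<Rightarrow> bool" where
  "unordered_joint_density M I X f \<longleftrightarrow>
     (\<forall>S\<in>sets (\<Pi>\<^sub>M i\<in>I. (lborel :: complex measure)).
        (\<forall>\<pi>. \<pi> permutes I \<longrightarrow> (\<forall>x\<in>S. x \<circ> \<pi> \<in> S)) \<longrightarrow>
        emeasure M {\<omega>\<in>space M. (\<lambda>i\<in>I. X i \<omega>) \<in> S}
          = (\<integral>\<^sup>+ x. ennreal (f x) * indicator S x \<partial>(\<Pi>\<^sub>M i\<in>I. lborel)))"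

lemma distributed_imp_unordered_joint_density:
  assumes "distributed M (\<Pi>\<^sub>M i\<in>I. (lborel :: complex measure))
             (\<lambda>\<omega>. \<lambda>i\<in>I. X i \<omega>) (\<lambda>x. ennreal (f x))"
  shows "unordered_joint_density M I X f"
  unfolding unordered_joint_density_def
proof (intro ballI impI)
  fix S assume "S \<in> sets (\<Pi>\<^sub>M i\<in>I. (lborel :: complex measure))"
  from distributed_emeasure[OF assms this]
  show "emeasure M {\<omega>\<in>space M. (\<lambda>i\<in>I. X i \<omega>) \<in> S}
          = (\<integral>\<^sup>+ x. ennreal (f x) * indicator S x \<partial>(\<Pi>\<^sub>M i\<in>I. lborel))"
    by (simp add: vimage_def Int_def conj_commute)
qed

(* The density is extended by 0 outside the open unit polydisc.  The exponent
   n - p - 1 is a subtraction on nat, which is exact for p < n. *)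
definition truncated_unitary_density :: "real \<Rightarrow> nat \<Rightarrow> nat \<Rightarrow> (nat \<Rightarrow> complex) \<Rightarrow> real" where
  "truncated_unitary_density C n p z =
     (if \<forall>j\<in>{1..p}. cmod (z j) < 1
      then C * (\<Prod>(j, k)\<in>{(j, k). 1 \<le> j \<and> j < k \<and> k \<le> p}. (cmod (z j - z k))\<^sup>2)
             * (\<Prod>j\<in>{1..p}. (1 - (cmod (z j))\<^sup>2) ^ (n - p - 1))
      else 0)"

(* Only the values at y > 3 are meaningful. *)
definition a_fun :: "real \<Rightarrow> real" where
  "a_fun y = (ln y) powr (1/2) - (ln y) powr (-1/2) * ln (sqrt (2 * pi) * ln y)"

definition b_fun :: "real \<Rightarrow> real" where
  "b_fun y = (ln y) powr (-1/2)"

definition c_seq :: "(nat \<Rightarrow> nat) \<Rightarrow> nat \<Rightarrow> real" where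
  "c_seq p n = sqrt ((real (p n) - 1) / (real n - 1))"

definition y_seq :: "(nat \<Rightarrow> nat) \<Rightarrow> nat \<Rightarrow> real" where
  "y_seq p n = real n * (c_seq p n)\<^sup>2 / (1 - (c_seq p n)\<^sup>2)"

definition A_seq :: "(nat \<Rightarrow> nat) \<Rightarrow> nat \<Rightarrow> real" where
  "A_seq p n = c_seq p n
     + 1/2 * sqrt (1 - (c_seq p n)\<^sup>2) * (real n - 1) powr (-1/2) * a_fun (y_seq p n)"

definition B_seq :: "(nat \<Rightarrow> nat) \<Rightarrow> nat \<Rightarrow> real" where
  "B_seq p n = 1/2 * sqrt (1 - (c_seq p n)\<^sup>2) * (real n - 1) powr (-1/2) * b_fun (y_seq p n)"

definition gumbel_cdf :: "real \<Rightarrow> real" where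
  "gumbel_cdf x = exp (- exp (- x))"

end

theory Submission
  imports Defs "HOL-Real_Asymp.Real_Asymp"
begin

text \<open>
  Monomials are orthogonal for every rotation-invariant weight on the disc, so expanding the
  squared Vandermonde determinant shows that the event that all moduli are at most \<open>r\<close> has probability
  \<open>\<Prod>k<p. (1 - q\<^sub>k)\<close>, where \<open>q\<^sub>k\<close> is the probability that a Beta variable with parameters
  \<open>k + 1\<close> and \<open>n - p\<close> exceeds \<open>r\<^sup>2\<close>. The sum of the \<open>q\<^sub>k\<close> telescopes into one integral
  of \<open>(s - x) s\<^sup>P (1 - s)\<^sup>l\<close> over \<open>[x, 1]\<close> with \<open>x = r\<^sup>2\<close>, \<open>P = p - 1\<close>, \<open>l = n - p - 1\<close>.
  Its integrand is log-concave, which gives matching exponential bounds (Laplace's method), and Stirling's formula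
  turns the result into \<open>sqrt y * exp (- v\<^sup>2 / 2) / (sqrt (2 pi) * v\<^sup>2)\<close> with
  \<open>v = a y + b y * t\<close>; the constants \<open>a\<close> and \<open>b\<close> are chosen so that this tends to \<open>exp (- t)\<close>.
  The largest \<open>q\<^sub>k\<close> vanishes in the limit, so the product tends to \<open>exp (- exp (- t))\<close>.
\<close>

section \<open>Incomplete Beta integrals\<close>

text \<open>The event that the maximum is at most r is symmetric in the eigenvalues, so the
  unordered density determines its probability; the constant \<open>C\<close> is never computed,
  because the level r = 1 fixes it. Estimating the factors of the product one by one would need a
  tail approximation uniform in k, over a number of relevant k that grows with n. The exact closed
  form of the sum removes this obstacle: one integral at one threshold remains, together with a
  proof that no single tail stays large. The constants come from solving sqrt y * exp(-v^2/2) =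
  sqrt(2 pi) * v^2 * exp(-t) for v. With L = ln y, and v^2 replaced by L on the right, this reads
  v^2 = L - 2 ln(sqrt(2 pi) L) + 2t, and the square root to first order is a + b t. Comparing the
  Beta weight with a Gaussian at distance v costs an error of order v^3 / sqrt(min(p - 1, n - p)) in
  the exponent, where v is of order sqrt(ln y). Both growth conditions are therefore used through a
  single requirement: (ln y)^3 is negligible against p - 1 and against n - p.\<close>

definition beta_integral :: "nat \<Rightarrow> nat \<Rightarrow> real \<Rightarrow> real" where
  "beta_integral k l x = integral {x..1} (\<lambda>s. s ^ k * (1 - s) ^ l)"

text \<open>The survival function of the Beta law with parameters k + 1 and l + 1; the fraction is
  the reciprocal of B(k + 1, l + 1).\<close>

definition beta_tail :: "nat \<Rightarrow> nat \<Rightarrow> real \<Rightarrow> real" where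
  "beta_tail k l x = fact (k + l + 1) / (fact k * fact l) * beta_integral k l x"

lemma beta_integral_0:
  assumes "x \<le> 1"
  shows "(real l + 1) * beta_integral 0 l x = (1 - x) ^ (l + 1)"
proof -
  have "((\<lambda>s. (real l + 1) * (1 - s) ^ l) has_integral (- ((1 - 1) ^ Suc l) - (- ((1 - x) ^ Suc l)))) {x..1::real}"
  proof (rule fundamental_theorem_of_calculus[OF assms])
    fix s :: real
    have "((\<lambda>s. - ((1 - s) ^ Suc l)) has_real_derivative (real l + 1) * (1 - s) ^ l) (at s within {x..1})"
      by (rule derivative_eq_intros refl)+ (simp add: algebra_simps)
    then show "((\<lambda>s. - ((1 - s) ^ Suc l)) has_vector_derivative (real l + 1) * (1 - s) ^ l) (at s within {x..1})"
      by (simp add: has_real_derivative_iff_has_vector_derivative)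
  qed
  from integral_unique[OF this] show ?thesis
    unfolding beta_integral_def by simp
qed

text \<open>Integrates the derivative of s^(k+1) (1-s)^(l+1) over [x, 1]; one factor 1 - s is
  expanded so that both resulting terms carry the same power (1-s)^l.\<close>

lemma beta_integral_Suc:
  assumes "x \<le> 1"
  shows "(real k + real l + 2) * beta_integral (Suc k) l x
    = (real k + 1) * beta_integral k l x + x ^ Suc k * (1 - x) ^ Suc l"
proof -
  have "((\<lambda>s. (real k + 1) * (s ^ k * (1 - s) ^ l) - (real k + real l + 2) * (s ^ Suc k * (1 - s) ^ l)) has_integral
          (1 ^ Suc k * (1 - 1) ^ Suc l - x ^ Suc k * (1 - x) ^ Suc l)) {x..1::real}"
  proof (rule fundamental_theorem_of_calculus[OF assms])
    fix s :: real
    have "((\<lambda>s. s ^ Suc k * (1 - s) ^ Suc l) has_real_derivative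
       (real k + 1) * (s ^ k * (1 - s) ^ l) - (real k + real l + 2) * (s ^ Suc k * (1 - s) ^ l)) (at s within {x..1})"
      by (rule derivative_eq_intros refl)+ (simp add: algebra_simps)
    then show "((\<lambda>s. s ^ Suc k * (1 - s) ^ Suc l) has_vector_derivative
       (real k + 1) * (s ^ k * (1 - s) ^ l) - (real k + real l + 2) * (s ^ Suc k * (1 - s) ^ l)) (at s within {x..1})"
      by (simp add: has_real_derivative_iff_has_vector_derivative)
  qed
  moreover have "((\<lambda>s. (real k + 1) * (s ^ k * (1 - s) ^ l) - (real k + real l + 2) * (s ^ Suc k * (1 - s) ^ l))
      has_integral (real k + 1) * beta_integral k l x - (real k + real l + 2) * beta_integral (Suc k) l x) {x..1}"
    unfolding beta_integral_def
    by (intro has_integral_diff has_integral_mult_right integrable_integral integrable_continuous_interval continuous_intros)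
  ultimately show ?thesis
    by (auto dest: has_integral_unique)
qed

text \<open>The normalised form of the recurrence. Its boundary term is nonnegative, which makes the
  tails increase in k, and it vanishes at x = 0, which yields the total mass 1 by induction.\<close>

lemma beta_tail_Suc:
  assumes "x \<le> 1"
  shows "beta_tail (Suc k) l x
    = beta_tail k l x + fact (k + l + 1) / (fact (Suc k) * fact l) * (x ^ Suc k * (1 - x) ^ Suc l)"
proof -
  have *: "beta_integral (Suc k) l x
     = ((real k + 1) * beta_integral k l x + x ^ Suc k * (1 - x) ^ Suc l) / (real k + real l + 2)"
    using beta_integral_Suc[OF assms, of k l] by (simp add: field_simps)
  have f: "fact (Suc k + l + 1) = (real k + real l + 2) * fact (k + l + 1)"
    by (simp add: algebra_simps)
  have "beta_tail (Suc k) l x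
     = fact (k + l + 1) / (fact (Suc k) * fact l) * ((real k + 1) * beta_integral k l x + x ^ Suc k * (1 - x) ^ Suc l)"
    unfolding beta_tail_def * f by (simp del: power_Suc fact_Suc)
  also have "\<dots> = beta_tail k l x + fact (k + l + 1) / (fact (Suc k) * fact l) * (x ^ Suc k * (1 - x) ^ Suc l)"
    unfolding distrib_left
  proof (rule arg_cong2[of _ _ _ _ "(+)", OF _ refl])
    have "real k + 1 \<noteq> 0" by simp
    then show "fact (k + l + 1) / (fact (Suc k) * fact l) * ((real k + 1) * beta_integral k l x) = beta_tail k l x"
      unfolding beta_tail_def by (simp add: add.commute)
  qed
  finally show ?thesis .
qed

lemma beta_tail_0: "beta_tail k l 0 = 1"
proof (induction k)
  case 0
  then show ?case
    using beta_integral_0[of 0 l] by (simp add: beta_tail_def field_simps flip: distrib_left)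
next
  case (Suc k)
  then show ?case
    using beta_tail_Suc[of 0 k l] by simp
qed

lemma beta_tail_mono:
  assumes "0 \<le> x" "x \<le> 1" "k \<le> k'"
  shows "beta_tail k l x \<le> beta_tail k' l x"
  using \<open>k \<le> k'\<close>
proof (induction k' rule: dec_induct)
  case (step k')
  have "0 \<le> fact (k' + l + 1) / (fact (Suc k') * fact l) * (x ^ Suc k' * (1 - x) ^ Suc l)"
    using assms by (intro mult_nonneg_nonneg divide_nonneg_nonneg) auto
  then show ?case
    using step beta_tail_Suc[OF assms(2), of k' l] by linarith
qed simp

lemma beta_tail_nonneg:
  assumes "0 \<le> x" "x \<le> 1"
  shows "0 \<le> beta_tail k l x"
  using assms unfolding beta_tail_def beta_integral_def
  by (intro mult_nonneg_nonneg integral_nonneg integrable_continuous_interval continuous_intros) auto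

text \<open>Multiplied by 1 - x, the new summand is the difference of two consecutive closed forms:
  two instances of the recurrence are combined with weights that make their boundary terms
  cancel.\<close>

lemma sum_beta_tail:
  assumes "x < 1"
  shows "(\<Sum>k<Suc q. beta_tail k l x)
    = fact (q + l + 2) / (fact q * fact l) / (1 - x) * (beta_integral (Suc q) l x - x * beta_integral q l x)"
proof -
  have x: "x \<le> 1" using assms by simp
  have "(1 - x) * (\<Sum>k<Suc q. beta_tail k l x)
    = fact (q + l + 2) / (fact q * fact l) * (beta_integral (Suc q) l x - x * beta_integral q l x)"
  proof (induction q)
    case 0
    have b0: "beta_integral 0 l x = (1 - x) ^ (l + 1) / (real l + 1)"
      using beta_integral_0[OF x, of l] by (simp add: field_simps)
    have b1: "beta_integral (Suc 0) l x = (beta_integral 0 l x + x * (1 - x) ^ Suc l) / (real l + 2)"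
      using beta_integral_Suc[OF x, of 0 l] by (simp add: field_simps)
    have "fact (0 + l + 2) = (real l + 2) * ((real l + 1) * fact l)"
      by (simp add: algebra_simps)
    then show ?case
      unfolding b1 by (simp add: beta_tail_def b0 divide_simps) (simp add: algebra_simps)
  next
    case (Suc q)
    \<comment> \<open>\<open>F\<close> is a common factor of the new tail and of both closed forms;
      after extracting it, the induction step is a linear identity in \<open>J0\<close>,
      \<open>J1\<close>, \<open>J2\<close>.\<close>
    define F where "F = (fact (q + l + 2) :: real) / (fact (Suc q) * fact l)"
    define J0 where "J0 = beta_integral q l x"
    define J1 where "J1 = beta_integral (Suc q) l x"
    define J2 where "J2 = beta_integral (Suc (Suc q)) l x"
    have e1: "(real q + real l + 2) * J1 = (real q + 1) * J0 + x ^ Suc q * (1 - x) ^ Suc l"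
      unfolding J0_def J1_def by (rule beta_integral_Suc[OF x])
    have e2: "(real q + real l + 3) * J2 = (real q + 2) * J1 + x * (x ^ Suc q * (1 - x) ^ Suc l)"
      unfolding J2_def J1_def using beta_integral_Suc[OF x, of "Suc q" l] by (simp add: algebra_simps)
    have t: "beta_tail (Suc q) l x = F * J1"
      by (simp add: beta_tail_def F_def J1_def del: fact_Suc)
    have F1: "fact (q + l + 2) / (fact q * fact l) = F * (real q + 1)"
    proof -
      have "G / (b * c) = G / (a * b * c) * a" if "a \<noteq> 0" for G a b c :: real
        using that by simp
      then show ?thesis
        by (simp add: F_def add.commute)
    qed
    have "fact (Suc q + l + 2) = (real q + real l + 3) * (fact (q + l + 2) :: real)"
      by (simp add: algebra_simps)
    then have F2: "fact (Suc q + l + 2) / (fact (Suc q) * fact l) = F * (real q + real l + 3)"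
      by (simp add: F_def del: fact_Suc)
    have "(real q + 1) * (J1 - x * J0) + (1 - x) * J1 = (real q + real l + 3) * (J2 - x * J1)"
    proof -
      have "(real q + real l + 3) * (J2 - x * J1)
        = (real q + real l + 3) * J2 - x * ((real q + real l + 2) * J1) - x * J1"
        by (simp add: algebra_simps)
      then show ?thesis
        unfolding e1 e2 by (simp add: algebra_simps)
    qed
    then have "F * ((real q + 1) * (J1 - x * J0) + (1 - x) * J1) = F * ((real q + real l + 3) * (J2 - x * J1))"
      by (rule arg_cong)
    then have "F * (real q + 1) * (J1 - x * J0) + (1 - x) * (F * J1) = F * (real q + real l + 3) * (J2 - x * J1)"
      by (simp add: algebra_simps)
    then show ?case
      unfolding sum.lessThan_Suc[of _ "Suc q"] distrib_left Suc.IH F1 F2 t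
      by (simp add: J0_def J1_def J2_def)
  qed
  then show ?thesis using assms by (simp add: field_simps)
qed

text \<open>Rewrites the difference in \<open>sum_beta_tail\<close> as one nonnegative integrand. A
  difference of two nearly equal integrals could not be estimated to leading order, whereas the
  excess of s over x can.\<close>

lemma beta_excess_eq:
  "beta_integral (Suc q) l x - x * beta_integral q l x = integral {x..1} (\<lambda>s. (s - x) * (s ^ q * (1 - s) ^ l))"
proof -
  have "((\<lambda>s. s ^ Suc q * (1 - s) ^ l - x * (s ^ q * (1 - s) ^ l)) has_integral
     beta_integral (Suc q) l x - x * beta_integral q l x) {x..1}"
    unfolding beta_integral_def
    by (intro has_integral_diff has_integral_mult_right integrable_integral integrable_continuous_interval continuous_intros)
  then show ?thesis
    by (auto dest!: integral_unique simp: algebra_simps)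
qed

text \<open>Markov's inequality for the excess over the lower level.\<close>

lemma beta_tail_le_sum:
  assumes "0 \<le> x'" "x' < x" "x \<le> 1"
  shows "beta_tail q l x \<le> (1 - x') / ((real q + real l + 2) * (x - x')) * (\<Sum>k<Suc q. beta_tail k l x')"
proof -
  have "(x - x') * beta_integral q l x = integral {x..1} (\<lambda>s. (x - x') * (s ^ q * (1 - s) ^ l))"
    by (simp add: beta_integral_def)
  also have "\<dots> \<le> integral {x..1} (\<lambda>s. (s - x') * (s ^ q * (1 - s) ^ l))"
    using assms by (intro integral_le integrable_continuous_interval continuous_intros) (auto intro!: mult_right_mono)
  also have "\<dots> \<le> integral {x'..1} (\<lambda>s. (s - x') * (s ^ q * (1 - s) ^ l))"
    using assms by (intro integral_subset_le integrable_continuous_interval continuous_intros) auto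
  finally have *: "beta_integral q l x \<le> (beta_integral (Suc q) l x' - x' * beta_integral q l x') / (x - x')"
    using assms by (simp add: beta_excess_eq field_simps)
  have "fact (q + l + 2) = (real q + real l + 2) * fact (q + l + 1)"
    by (simp add: algebra_simps)
  then have f: "(fact (q + l + 1) :: real) = fact (q + l + 2) / (real q + real l + 2)"
    by (simp add: field_simps)
  have "beta_tail q l x \<le> fact (q + l + 1) / (fact q * fact l) * ((beta_integral (Suc q) l x' - x' * beta_integral q l x') / (x - x'))"
    unfolding beta_tail_def by (intro mult_left_mono *) simp
  also have "\<dots> = (1 - x') / ((real q + real l + 2) * (x - x')) * (\<Sum>k<Suc q. beta_tail k l x')"
  proof -
    have "F / Q / D * (G / u) = w / (Q * u) * (F / D / w * G)" if "w \<noteq> 0" for F Q D G u w :: real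
      using that by simp
    then show ?thesis
      using assms by (simp only: f sum_beta_tail[of x' l q])
  qed
  finally show ?thesis .
qed

text \<open>The upper bound is 1 - u \<le> exp(-u). The lower one comes from 1/(1-u) = 1 + u/(1-u)
  \<le> exp(u/(1-e)). When the sum converges and the uniform bound e tends to 0, the two bounds
  meet.\<close>

lemma prod_one_minus_bounds:
  fixes f :: "nat \<Rightarrow> real"
  assumes "\<And>k. k < q \<Longrightarrow> 0 \<le> f k" "\<And>k. k < q \<Longrightarrow> f k \<le> e" "e < 1"
  shows "(\<Prod>k<q. 1 - f k) \<le> exp (- (\<Sum>k<q. f k))"
    and "exp (- (\<Sum>k<q. f k) / (1 - e)) \<le> (\<Prod>k<q. 1 - f k)"
proof -
  have "(\<Prod>k<q. 1 - f k) \<le> (\<Prod>k<q. exp (- f k))"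
  proof (rule prod_mono)
    fix k assume "k \<in> {..<q}"
    then have "f k < 1" using assms(2)[of k] assms(3) by simp
    then show "0 \<le> 1 - f k \<and> 1 - f k \<le> exp (- f k)"
      using exp_ge_add_one_self[of "- f k"] by simp
  qed
  then show "(\<Prod>k<q. 1 - f k) \<le> exp (- (\<Sum>k<q. f k))"
    by (simp add: exp_sum[symmetric] sum_negf)
  have "(\<Prod>k<q. exp (- f k / (1 - e))) \<le> (\<Prod>k<q. 1 - f k)"
  proof (rule prod_mono)
    fix k assume "k \<in> {..<q}"
    then have k: "0 \<le> f k" "f k \<le> e" using assms by auto
    have "1 / (1 - f k) = 1 + f k / (1 - f k)"
      using k assms(3) by (simp add: field_simps)
    also have "\<dots> \<le> 1 + f k / (1 - e)"
      using k assms(3) by (intro add_left_mono divide_left_mono) auto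
    also have "\<dots> \<le> exp (f k / (1 - e))"
      by (rule exp_ge_add_one_self)
    finally have "1 / (1 - f k) \<le> exp (f k / (1 - e))" .
    then have "exp (- (f k / (1 - e))) \<le> 1 - f k"
      using k assms(3) by (simp add: exp_minus field_simps)
    then show "0 \<le> exp (- f k / (1 - e)) \<and> exp (- f k / (1 - e)) \<le> 1 - f k"
      by simp
  qed
  then show "exp (- (\<Sum>k<q. f k) / (1 - e)) \<le> (\<Prod>k<q. 1 - f k)"
    by (simp add: exp_sum[symmetric] sum_negf sum_divide_distrib)
qed

section \<open>Stirling's formula\<close>

definition stirling_ratio :: "nat \<Rightarrow> real" where
  "stirling_ratio n = fact n * exp (real n) / (sqrt (real n) * real n ^ n)"

lemma stirling_ratio_pos: "n > 0 \<Longrightarrow> stirling_ratio n > 0"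
  by (simp add: stirling_ratio_def)

lemma fact_eq_stirling_ratio:
  assumes "n > 0"
  shows "fact n = stirling_ratio n * sqrt (real n) * real n ^ n * exp (- real n)"
  using assms by (simp add: stirling_ratio_def exp_minus field_simps)

lemma ln_stirling_ratio:
  assumes "n > 0"
  shows "ln (stirling_ratio n) = ln (fact n) + real n - (real n + 1 / 2) * ln (real n)"
  using assms
  by (simp add: stirling_ratio_def ln_div ln_mult ln_sqrt ln_realpow algebra_simps)

lemma ln_stirling_ratio_diff:
  assumes "n > 0"
  shows "ln (stirling_ratio n) - ln (stirling_ratio (Suc n)) = (real n + 1 / 2) * (ln (real n + 1) - ln (real n)) - 1"
proof -
  have f: "ln (fact (Suc n) :: real) = ln (real n + 1) + ln (fact n)"
    by (simp add: ln_mult add.commute)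
  have r: "real (Suc n) = real n + 1" by simp
  have "ln (stirling_ratio (Suc n)) = ln (real n + 1) + ln (fact n) + (real n + 1) - (real n + 1 + 1 / 2) * ln (real n + 1)"
    using ln_stirling_ratio[of "Suc n"] unfolding f r by simp
  then show ?thesis
    using ln_stirling_ratio[OF assms] by (simp add: algebra_simps)
qed

text \<open>The difference ln(n+1) - ln n is the integral of the convex function 1/x over [n, n+1]:
  the midpoint rule bounds it from below and the trapezoidal rule from above. The trapezoidal error
  telescopes, so the decreasing sequence is bounded below.\<close>

lemma ln_stirling_ratio_bounds:
  assumes "n > 0"
  shows "ln (stirling_ratio (Suc n)) \<le> ln (stirling_ratio n)"
    and "ln (stirling_ratio n) - 1 / (4 * real n) \<le> ln (stirling_ratio (Suc n)) - 1 / (4 * real (Suc n))"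
proof -
  have n: "real n > 0" using assms by simp
  have "2 / (2 * real n + 1) \<le> ln (real n + 1) - ln (real n)"
    using ln_inverse_approx_ge[of "real n" "real n + 1"] n by (simp add: add_divide_distrib algebra_simps)
  then have "(real n + 1 / 2) * (2 / (2 * real n + 1)) \<le> (real n + 1 / 2) * (ln (real n + 1) - ln (real n))"
    by (intro mult_left_mono) auto
  moreover have "(real n + 1 / 2) * (2 / (2 * real n + 1)) = 1"
    using n by (simp add: field_simps)
  ultimately show "ln (stirling_ratio (Suc n)) \<le> ln (stirling_ratio n)"
    using ln_stirling_ratio_diff[OF assms] by linarith
  have "ln (real n + 1) - ln (real n) \<le> (1 / real n + 1 / (real n + 1)) / 2"
    using ln_inverse_approx_le[of "real n" 1] n by (simp add: inverse_eq_divide)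
  then have "(real n + 1 / 2) * (ln (real n + 1) - ln (real n)) \<le> (real n + 1 / 2) * ((1 / real n + 1 / (real n + 1)) / 2)"
    by (intro mult_left_mono) auto
  also have "\<dots> = 1 + (1 / (4 * real n) - 1 / (4 * (real n + 1)))"
    using n by (simp add: divide_simps) (simp add: algebra_simps)
  finally show "ln (stirling_ratio n) - 1 / (4 * real n) \<le> ln (stirling_ratio (Suc n)) - 1 / (4 * real (Suc n))"
    using ln_stirling_ratio_diff[OF assms] by (simp add: add.commute)
qed

lemma stirling_ratio_convergent: "\<exists>c>0. stirling_ratio \<longlonglongrightarrow> c"
proof -
  \<comment> \<open>The shift avoids index 0, where \<open>stirling_ratio\<close> has the value 0
    through division by zero.\<close>
  define d where "d n = ln (stirling_ratio (Suc n))" for n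
  have "decseq d"
    unfolding d_def by (rule decseq_SucI) (rule ln_stirling_ratio_bounds, simp)
  moreover have "d 0 - 1 / 4 \<le> d n - 1 / (4 * real (Suc n))" for n
  proof (induction n)
    case (Suc n)
    then show ?case
      using ln_stirling_ratio_bounds(2)[of "Suc n"] unfolding d_def by linarith
  qed simp
  moreover have "d n - 1 / (4 * real (Suc n)) \<le> d n" for n
    by simp
  ultimately have "decseq d" "d 0 - 1 / 4 \<le> d n" for n
    using order_trans by blast+
  then obtain l where "d \<longlonglongrightarrow> l"
    using decseq_convergent[of d "d 0 - 1 / 4"] by blast
  then have "(\<lambda>n. exp (d n)) \<longlonglongrightarrow> exp l"
    by (rule tendsto_exp)
  then have "(\<lambda>n. stirling_ratio (Suc n)) \<longlonglongrightarrow> exp l"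
    by (simp add: d_def stirling_ratio_pos)
  then have "stirling_ratio \<longlonglongrightarrow> exp l"
    by (simp add: filterlim_sequentially_Suc)
  then show ?thesis
    by (intro exI[of _ "exp l"]) simp
qed

text \<open>Expresses the Wallis product by the factorials of n and 2n, which is the form needed to
  identify the constant in Stirling's formula.\<close>

lemma wallis_product_eq:
  "(\<Prod>k=1..n. (4 * real k ^ 2) / (4 * real k ^ 2 - 1)) = 16 ^ n * fact n ^ 4 / (fact (2 * n) ^ 2 * (2 * real n + 1))"
proof (induction n)
  case (Suc n)
  have f: "fact (2 * Suc n) = (2 * real n + 2) * (2 * real n + 1) * fact (2 * n)"
    by (simp add: algebra_simps)
  have g: "(4 * real (Suc n) ^ 2) / (4 * real (Suc n) ^ 2 - 1) = (2 * real n + 2)\<^sup>2 / ((2 * real n + 1) * (2 * real n + 3))"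
    by (simp add: power2_eq_square algebra_simps)
  have step: "16 ^ Suc n * (b * F) ^ 4 / ((c * d * G)\<^sup>2 * e) = 16 ^ n * F ^ 4 / (G\<^sup>2 * d) * (c\<^sup>2 / (d * e))"
    if "c > 0" "d > 0" "e > 0" "G > 0" "c = 2 * b" for b c d e F G :: real
  proof -
    have "16 ^ Suc n * (b * F) ^ 4 = 16 ^ n * F ^ 4 * (c\<^sup>2 * c\<^sup>2)"
      unfolding that(5) by (simp add: power_mult_distrib)
    moreover have "(c * d * G)\<^sup>2 * e = c\<^sup>2 * (G\<^sup>2 * d * (d * e))"
      by (simp add: power2_eq_square)
    ultimately have "16 ^ Suc n * (b * F) ^ 4 / ((c * d * G)\<^sup>2 * e)
      = 16 ^ n * F ^ 4 * (c\<^sup>2 * c\<^sup>2) / (c\<^sup>2 * (G\<^sup>2 * d * (d * e)))"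
      by (simp only:)
    also have "16 ^ n * F ^ 4 * (c\<^sup>2 * c\<^sup>2) / (c\<^sup>2 * (G\<^sup>2 * d * (d * e)))
      = 16 ^ n * F ^ 4 / (G\<^sup>2 * d) * (c\<^sup>2 / (d * e))"
    proof -
      have "X * (C * C) / (C * (g * (d * e))) = X / g * (C / (d * e))" if "C \<noteq> 0" for X C g d e :: real
        using that by simp
      from this[of "c\<^sup>2"] show ?thesis
        using \<open>c > 0\<close> by (simp only: power_eq_0_iff) simp
    qed
    finally show ?thesis .
  qed
  have "(\<Prod>k=1..Suc n. (4 * real k ^ 2) / (4 * real k ^ 2 - 1))
    = (\<Prod>k=1..n. (4 * real k ^ 2) / (4 * real k ^ 2 - 1)) * ((4 * real (Suc n) ^ 2) / (4 * real (Suc n) ^ 2 - 1))"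
    by (subst prod.nat_ivl_Suc') (simp_all add: mult.commute)
  also have "\<dots> = 16 ^ n * fact n ^ 4 / (fact (2 * n) ^ 2 * (2 * real n + 1)) * ((2 * real n + 2)\<^sup>2 / ((2 * real n + 1) * (2 * real n + 3)))"
    by (simp only: Suc.IH g)
  also have "\<dots> = 16 ^ Suc n * ((real n + 1) * fact n) ^ 4 / (((2 * real n + 2) * (2 * real n + 1) * fact (2 * n))\<^sup>2 * (2 * real n + 3))"
    by (rule step[symmetric]) auto
  also have "\<dots> = 16 ^ Suc n * fact (Suc n) ^ 4 / (fact (2 * Suc n) ^ 2 * (2 * real (Suc n) + 1))"
    unfolding f by (simp add: add.commute)
  finally show ?case .
qed simp

text \<open>If c is the limit, then r(n)^4 / r(2n)^2 tends to c^2. Up to a factor tending to 1/4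
  this quotient is the Wallis product with limit pi/2, so c^2 = 2 pi.\<close>

lemma stirling_ratio_tendsto: "stirling_ratio \<longlonglongrightarrow> sqrt (2 * pi)"
proof -
  obtain c where c: "c > 0" "stirling_ratio \<longlonglongrightarrow> c"
    using stirling_ratio_convergent by blast
  have c2: "(\<lambda>n. stirling_ratio (2 * n)) \<longlonglongrightarrow> c"
    by (rule filterlim_compose[OF c(2)]) (rule mult_nat_left_at_top, simp)
  have lim: "(\<lambda>n. real n / (2 * (2 * real n + 1))) \<longlonglongrightarrow> 1 / 4"
    by real_asymp
  have "(\<lambda>n. stirling_ratio n ^ 4 / stirling_ratio (2 * n) ^ 2 * (real n / (2 * (2 * real n + 1)))) \<longlonglongrightarrow> c ^ 4 / c ^ 2 * (1 / 4)"
    using c by (intro tendsto_intros c2 lim) auto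
  moreover have "\<forall>\<^sub>F n in sequentially. stirling_ratio n ^ 4 / stirling_ratio (2 * n) ^ 2 * (real n / (2 * (2 * real n + 1)))
     = (\<Prod>k=1..n. (4 * real k ^ 2) / (4 * real k ^ 2 - 1))"
    using eventually_gt_at_top[of 0]
  proof eventually_elim
    case (elim n)
    define A where "A = real n ^ n * exp (- real n)"
    have A: "A > 0" using elim by (simp add: A_def)
    have f1: "fact n = stirling_ratio n * sqrt (real n) * A"
      using fact_eq_stirling_ratio[OF elim] by (simp add: A_def)
    have "real (2 * n) ^ (2 * n) * exp (- real (2 * n)) = 4 ^ n * A\<^sup>2"
    proof -
      have "exp (- real (2 * n)) = (exp (- real n))\<^sup>2"
        by (simp add: power2_eq_square exp_add[symmetric])
      moreover have "real (2 * n) ^ (2 * n) = 4 ^ n * (real n ^ n)\<^sup>2"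
        by (simp add: power_mult_distrib power_mult[of 2 2] power_mult[symmetric] mult.commute[of n])
      ultimately show ?thesis
        by (simp add: A_def power_mult_distrib)
    qed
    then have f2: "fact (2 * n) = stirling_ratio (2 * n) * sqrt (real (2 * n)) * (4 ^ n * A\<^sup>2)"
      using fact_eq_stirling_ratio[of "2 * n"] elim by (simp add: mult.assoc)
    have s: "stirling_ratio (2 * n) > 0" using elim by (simp add: stirling_ratio_pos)
    have "sqrt (real n) ^ 4 = real n ^ 2"
      using power_mult[of "sqrt (real n)" 2 2] by simp
    then have g1: "fact n ^ 4 = stirling_ratio n ^ 4 * real n ^ 2 * A ^ 4"
      unfolding f1 by (simp add: power_mult_distrib)
    have "(4 ^ n) ^ 2 = (16 ^ n :: real)"
      by (simp add: power_mult[symmetric] mult.commute[of n 2]) (simp add: power_mult)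
    moreover have "(A\<^sup>2)\<^sup>2 = A ^ 4" by simp
    ultimately have g2: "(fact (2 * n))\<^sup>2 = stirling_ratio (2 * n) ^ 2 * (2 * real n) * (16 ^ n * A ^ 4)"
      unfolding f2 power_mult_distrib by simp
    have alg: "u / t * (r / (2 * D)) = W * (u * r\<^sup>2 * B) / (t * (2 * r) * (W * B) * D)"
      if "W > 0" "r > 0" "B > 0" for u t r D W B :: real
      using that by (simp add: power2_eq_square)
    show ?case
      unfolding wallis_product_eq g1 g2 by (rule alg) (use A elim in simp_all)
  qed
  ultimately have "(\<lambda>n. \<Prod>k=1..n. (4 * real k ^ 2) / (4 * real k ^ 2 - 1)) \<longlonglongrightarrow> c ^ 4 / c ^ 2 * (1 / 4)"
    by (rule Lim_transform_eventually)
  from LIMSEQ_unique[OF this wallis] have "c\<^sup>2 = 2 * pi"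
    using c(1) by (simp add: field_simps power2_eq_square power4_eq_xxxx)
  then have "c = sqrt (2 * pi)"
    using c(1) real_sqrt_unique[of c "2 * pi"] by simp
  with c(2) show ?thesis by simp
qed

text \<open>The local limit theorem at the mode: the binomial law with P + m trials and success
  probability P / (P + m) puts mass about 1 / (sqrt(2 pi) * standard deviation) on the value P. In
  the quotient of the three Stirling ratios all exponentials cancel.\<close>

lemma binomial_weight_asymp:
  fixes P m :: "nat \<Rightarrow> nat"
  assumes "filterlim P at_top sequentially" "filterlim m at_top sequentially"
  shows "(\<lambda>n. fact (P n + m n) / (fact (P n) * fact (m n))
      * (real (P n) / real (P n + m n)) ^ P n * (real (m n) / real (P n + m n)) ^ m n
      * sqrt (real (P n) * real (m n) / real (P n + m n))) \<longlonglongrightarrow> 1 / sqrt (2 * pi)"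
proof -
  have N: "filterlim (\<lambda>n. P n + m n) at_top sequentially"
    by (rule filterlim_at_top_mono[OF assms(1)]) simp
  note lims = assms[THEN filterlim_compose[OF stirling_ratio_tendsto]] filterlim_compose[OF stirling_ratio_tendsto N]
  have "(\<lambda>n. stirling_ratio (P n + m n) / (stirling_ratio (P n) * stirling_ratio (m n)))
     \<longlonglongrightarrow> sqrt (2 * pi) / (sqrt (2 * pi) * sqrt (2 * pi))"
    by (rule tendsto_divide[OF lims(3) tendsto_mult[OF lims(1,2)]]) simp
  moreover have "\<forall>\<^sub>F n in sequentially. stirling_ratio (P n + m n) / (stirling_ratio (P n) * stirling_ratio (m n))
    = fact (P n + m n) / (fact (P n) * fact (m n))
      * (real (P n) / real (P n + m n)) ^ P n * (real (m n) / real (P n + m n)) ^ m n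
      * sqrt (real (P n) * real (m n) / real (P n + m n))"
  proof -
    note pos = assms[THEN eventually_compose_filterlim[OF eventually_gt_at_top[of 0]]]
    from pos show ?thesis
    proof eventually_elim
      case (elim n)
      define a where "a = P n"
      define b where "b = m n"
      have ab: "a > 0" "b > 0" using elim by (simp_all add: a_def b_def)
      have "stirling_ratio (a + b) / (stirling_ratio a * stirling_ratio b)
        = fact (a + b) / (fact a * fact b)
        * (real a / real (a + b)) ^ a * (real b / real (a + b)) ^ b
        * sqrt (real a * real b / real (a + b))"
      proof -
        have alg: "F * (X * Y) / (SN * (Na * Nb)) / (f * X / (Sa * A) * (g * Y / (Sb * B)))
          = F / (f * g) * (A / Na) * (B / Nb) * (Sa * Sb / SN)"
          if "X > 0" "Y > 0" for F X Y SN Na Nb f Sa A g Sb B :: real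
          using that by (simp add: mult_ac)
        have e: "exp (real (a + b)) = exp (real a) * exp (real b)"
          by (simp add: exp_add)
        show ?thesis
          unfolding stirling_ratio_def power_divide real_sqrt_divide real_sqrt_mult power_add[of "real (a + b)"] e
          by (rule alg) simp_all
      qed
      then show ?case by (simp add: a_def b_def)
    qed
  qed
  ultimately have "(\<lambda>n. fact (P n + m n) / (fact (P n) * fact (m n))
      * (real (P n) / real (P n + m n)) ^ P n * (real (m n) / real (P n + m n)) ^ m n
      * sqrt (real (P n) * real (m n) / real (P n + m n))) \<longlonglongrightarrow> sqrt (2 * pi) / (sqrt (2 * pi) * sqrt (2 * pi))"
    by (rule Lim_transform_eventually)
  moreover have "sqrt (2 * pi) / (sqrt (2 * pi) * sqrt (2 * pi)) = 1 / sqrt (2 * pi)"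
    by (rule nonzero_divide_mult_cancel_left) simp
  ultimately show ?thesis by (simp only:)
qed

section \<open>Rotation invariance of planar Lebesgue measure\<close>

lemma image_ball_unit_mult:
  fixes c :: complex
  assumes "cmod c = 1"
  shows "(*) c ` ball a r = ball (c * a) r"
proof -
  have "c \<noteq> 0" using assms by auto
  have d: "dist (c * a) w = dist a (w / c)" for w
  proof -
    have "c * a - w = c * (a - w / c)" using \<open>c \<noteq> 0\<close> by (simp add: field_simps)
    then show ?thesis using assms by (simp add: dist_norm norm_mult)
  qed
  show ?thesis
  proof (intro equalityI subsetI)
    fix w assume "w \<in> (*) c ` ball a r"
    then show "w \<in> ball (c * a) r" using \<open>c \<noteq> 0\<close> by (auto simp: d)
  next
    fix w assume "w \<in> ball (c * a) r"
    then have "w / c \<in> ball a r" by (simp add: d)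
    moreover have "w = c * (w / c)" using \<open>c \<noteq> 0\<close> by simp
    ultimately show "w \<in> (*) c ` ball a r" by blast
  qed
qed

text \<open>An open set is a countable disjoint union of balls up to a null set (Vitali), and balls
  are mapped to balls of the same radius.\<close>

lemma emeasure_lborel_open_le_unit_mult:
  fixes c :: complex
  assumes c: "cmod c = 1" and U: "open U"
  shows "emeasure lborel U \<le> emeasure lborel ((*) c ` U)"
proof -
  have "c \<noteq> 0" using c by auto
  define K where "K = {(a, r). 0 < r \<and> ball a r \<subseteq> U}"
  have cover: "\<exists>i. i \<in> K \<and> x \<in> ball (fst i) (snd i) \<and> snd i < d" if "x \<in> U" "0 < d" for x d
  proof -
    obtain e where e: "e > 0" "ball x e \<subseteq> U" using U \<open>x \<in> U\<close> open_contains_ball by blast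
    then have "(x, min e (d / 2)) \<in> K" using that by (auto simp: K_def)
    then show ?thesis using e that by (intro exI[of _ "(x, min e (d / 2))"]) auto
  qed
  obtain C where C: "countable C" "C \<subseteq> K"
     "pairwise (\<lambda>i j. disjnt (ball (fst i) (snd i)) (ball (fst j) (snd j))) C"
     "negligible (U - (\<Union>i \<in> C. ball (fst i) (snd i)))"
    by (rule Vitali_covering_theorem_balls[OF cover])
  define V where "V = (\<Union>i \<in> C. ball (fst i) (snd i))"
  have VU: "V \<subseteq> U"
  proof
    fix w assume "w \<in> V"
    then obtain i where i: "i \<in> C" "w \<in> ball (fst i) (snd i)" unfolding V_def by blast
    then have "i \<in> K" using C(2) by blast
    then have "ball (fst i) (snd i) \<subseteq> U" by (auto simp: K_def)
    then show "w \<in> U" using i(2) by blast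
  qed
  have V: "V \<in> sets lborel" by (auto simp: V_def intro!: borel_open)
  have Ub: "U \<in> sets lborel" using U by auto
  have "U - V \<in> null_sets lborel"
    using C(4) Ub V by (auto simp: V_def[symmetric] negligible_iff_null_sets null_sets_completion_iff)
  then have "emeasure lborel U = emeasure lborel V"
    using emeasure_Un_null_set[OF V, of "U - V"] VU by (simp add: Un_absorb1)
  also have "\<dots> = (\<integral>\<^sup>+i. emeasure lborel (ball (fst i) (snd i)) \<partial>count_space C)"
    unfolding V_def using C(1,3)
    by (intro emeasure_UN_countable) (auto simp: disjoint_family_on_def pairwise_def disjnt_def)
  also have "\<dots> = (\<integral>\<^sup>+i. emeasure lborel ((*) c ` ball (fst i) (snd i)) \<partial>count_space C)"
  proof (rule nn_integral_cong)
    fix i assume "i \<in> space (count_space C)"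
    then have "snd i \<ge> 0" using C(2) by (auto simp: K_def)
    then show "emeasure lborel (ball (fst i) (snd i)) = emeasure lborel ((*) c ` ball (fst i) (snd i))"
      by (simp add: image_ball_unit_mult[OF c] emeasure_ball)
  qed
  also have "\<dots> = emeasure lborel (\<Union>i \<in> C. (*) c ` ball (fst i) (snd i))"
  proof (rule emeasure_UN_countable[symmetric])
    have "inj ((*) c)" using \<open>c \<noteq> 0\<close> by (simp add: inj_on_def)
    then show "disjoint_family_on (\<lambda>i. (*) c ` ball (fst i) (snd i)) C"
      using C(3) by (simp add: disjoint_family_on_def pairwise_def disjnt_def image_Int[symmetric])
  qed (use C(1) in \<open>auto simp: image_ball_unit_mult[OF c]\<close>)
  also have "\<dots> \<le> emeasure lborel ((*) c ` U)"
    using VU open_times_image[OF \<open>c \<noteq> 0\<close> U] by (intro emeasure_mono) (auto simp: V_def)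
  finally show ?thesis .
qed

text \<open>The inverse of c also has modulus 1, so the one-sided bound applied to the image set
  gives the converse inequality.\<close>

lemma emeasure_lborel_open_unit_mult:
  fixes c :: complex
  assumes c: "cmod c = 1" and U: "open U"
  shows "emeasure lborel ((*) c ` U) = emeasure lborel U"
proof (rule antisym)
  have "c \<noteq> 0" using c by auto
  have "emeasure lborel ((*) c ` U) \<le> emeasure lborel ((*) (inverse c) ` (*) c ` U)"
    using c U \<open>c \<noteq> 0\<close> by (intro emeasure_lborel_open_le_unit_mult open_times_image) (simp_all add: norm_inverse)
  also have "(*) (inverse c) ` (*) c ` U = U"
    using \<open>c \<noteq> 0\<close> by (simp add: image_image mult.assoc[symmetric])
  finally show "emeasure lborel ((*) c ` U) \<le> emeasure lborel U" .
qed (rule emeasure_lborel_open_le_unit_mult[OF assms])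

lemma lborel_distr_unit_mult:
  fixes c :: complex
  assumes c: "cmod c = 1"
  shows "distr lborel borel ((*) c) = lborel"
proof (rule measure_eqI_generator_eq[where \<Omega> = UNIV and E = "{S. open S}" and A = "\<lambda>i. ball 0 (real i)"])
  have "c \<noteq> 0" using c by auto
  have eq: "emeasure (distr lborel borel ((*) c)) U = emeasure lborel U" if U: "open U" for U
  proof -
    have "(*) c -` U = (*) (inverse c) ` U"
    proof (intro equalityI subsetI)
      fix x assume "x \<in> (*) c -` U"
      moreover have "x = inverse c * (c * x)" using \<open>c \<noteq> 0\<close> by simp
      ultimately show "x \<in> (*) (inverse c) ` U" by blast
    next
      fix x assume "x \<in> (*) (inverse c) ` U"
      then obtain u where "u \<in> U" "x = inverse c * u" by blast
      then have "c * x = u" using \<open>c \<noteq> 0\<close> by (simp add: field_simps)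
      then show "x \<in> (*) c -` U" using \<open>u \<in> U\<close> by simp
    qed
    then show ?thesis
      using U c by (simp add: emeasure_distr emeasure_lborel_open_unit_mult norm_inverse)
  qed
  then show "\<And>X. X \<in> {S. open S} \<Longrightarrow> emeasure (distr lborel borel ((*) c)) X = emeasure lborel X"
    by simp
  show "emeasure (distr lborel borel ((*) c)) (ball 0 (real i)) \<noteq> \<infinity>" for i
    by (simp add: eq emeasure_ball)
  show "(\<Union>i. ball 0 (real i)) = (UNIV :: complex set)"
    using reals_Archimedean2 by (auto simp: dist_norm)
qed (auto simp: Int_stable_def borel_def)

text \<open>A single well-chosen rotation turns the integrand into its negative, so the integral
  equals its own negative; no polar coordinates are required.\<close>

lemma integral_monomial_radial_orthogonal:
  fixes g :: "real \<Rightarrow> real"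
  assumes "a \<noteq> b"
  shows "(\<integral>z. z ^ a * cnj z ^ b * complex_of_real (g (cmod z)) \<partial>lborel) = 0"
proof -
  define h where "h z = z ^ a * cnj z ^ b * complex_of_real (g (cmod z))" for z
  \<comment> \<open>The angle is chosen such that c^a * cnj(c)^b = cis((a - b) * angle) = cis pi =
    -1.\<close>
  define c where "c = cis (pi / (real a - real b))"
  have c: "cmod c = 1" by (simp add: c_def)
  have "c ^ a * cnj c ^ b = cis (real a * (pi / (real a - real b)) - real b * (pi / (real a - real b)))"
    by (simp add: c_def cis_cnj Complex.DeMoivre cis_mult)
  also have "real a * (pi / (real a - real b)) - real b * (pi / (real a - real b)) = pi"
    by (simp only: left_diff_distrib[symmetric]) (use assms in simp)
  finally have "c ^ a * cnj c ^ b = -1" by simp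
  moreover have "h (c * z) = (c ^ a * cnj c ^ b) * h z" for z
    by (simp add: h_def norm_mult c power_mult_distrib)
  ultimately have neg: "h (c * z) = - h z" for z
    by simp
  show ?thesis
  proof (cases "h \<in> borel_measurable lborel")
    case True
    have "(\<integral>z. h z \<partial>lborel) = (\<integral>z. h z \<partial>distr lborel borel ((*) c))"
      by (simp add: lborel_distr_unit_mult[OF c])
    also have "\<dots> = (\<integral>z. h (c * z) \<partial>lborel)"
      using True by (intro integral_distr) auto
    also have "\<dots> = - (\<integral>z. h z \<partial>lborel)"
      by (simp add: neg)
    finally show ?thesis
      unfolding h_def[symmetric] by simp
  next
    \<comment> \<open>A non-integrable function has integral 0 by convention, which is why
      \<open>g\<close> may be an arbitrary function.\<close>
    case False
    then have "\<not> integrable lborel h" by (auto dest: borel_measurable_integrable)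
    then show ?thesis unfolding h_def[symmetric] by (rule not_integrable_integral_eq)
  qed
qed

text \<open>A disc of radius sqrt t has area pi * t, so in the variable t = |z|^2 planar measure is
  pi times Lebesgue measure on the half-line. This is also the variable in which the radial
  integrals become Beta integrals.\<close>

lemma distr_lborel_cmod_power2:
  "distr lborel borel (\<lambda>z. (cmod z)\<^sup>2) = density lborel (\<lambda>t. ennreal pi * indicator {0..} t)"
proof (rule measure_eqI_generator_eq[where \<Omega> = UNIV and E = "range (\<lambda>t::real. {..t})" and A = "\<lambda>i. {..real i}"])
  have d: "emeasure (distr lborel borel (\<lambda>z. (cmod z)\<^sup>2)) {..t} = ennreal (pi * max 0 t)" for t
  proof (cases "t < 0")
    case True
    have "(\<lambda>z. (cmod z)\<^sup>2) -` {..t} = {}"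
      using True by (auto dest: order_trans[OF zero_le_power2])
    then show ?thesis using True by (simp add: emeasure_distr max_def)
  next
    case False
    then have "(\<lambda>z. (cmod z)\<^sup>2) -` {..t} = cball 0 (sqrt t)"
      by (auto simp: real_le_rsqrt dist_norm) (metis abs_norm_cancel real_sqrt_abs real_sqrt_le_iff norm_ge_zero real_le_rsqrt real_sqrt_ge_0_iff sqrt_le_D)
    then show ?thesis
      using False by (simp add: emeasure_distr emeasure_cball unit_ball_vol_2 max_def)
  qed
  show "emeasure (distr lborel borel (\<lambda>z. (cmod z)\<^sup>2)) X = emeasure (density lborel (\<lambda>t. ennreal pi * indicator {0..} t)) X"
    if X: "X \<in> range (\<lambda>t. {..t})" for X
  proof -
    obtain t where t: "X = {..t}" using X by auto
    have "emeasure (density lborel (\<lambda>t. ennreal pi * indicator {0..} t)) X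
       = (\<integral>\<^sup>+u. ennreal pi * indicator {0..t} u \<partial>lborel)"
      unfolding t by (subst emeasure_density) (auto intro!: nn_integral_cong split: split_indicator)
    also have "\<dots> = ennreal pi * emeasure lborel {0..t}"
      by (subst nn_integral_cmult) auto
    also have "\<dots> = ennreal (pi * max 0 t)"
      by (cases "t \<ge> 0") (simp_all add: ennreal_mult max_def)
    finally show ?thesis unfolding t d by simp
  qed
  show "emeasure (distr lborel borel (\<lambda>z. (cmod z)\<^sup>2)) {..real i} \<noteq> \<infinity>" for i
    by (simp add: d)
  show "(\<Union>i. {..real i}) = UNIV"
    using real_arch_simple by auto
  show "Int_stable (range (\<lambda>t::real. {..t}))"
    by (auto simp: Int_stable_def)
  show "sets (distr lborel borel (\<lambda>z. (cmod z)\<^sup>2)) = sigma_sets UNIV (range (\<lambda>t::real. {..t}))"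
    using arg_cong[OF borel_eq_atMost[where 'a = real], of sets] by simp
  then show "sets (density lborel (\<lambda>t. ennreal pi * indicator {0..} t)) = sigma_sets UNIV (range (\<lambda>t::real. {..t}))"
    by simp
qed auto

lemma integral_radial:
  fixes f :: "real \<Rightarrow> real"
  assumes [measurable]: "f \<in> borel_measurable borel"
  shows "(\<integral>z. f ((cmod z)\<^sup>2) \<partial>lborel) = pi * (\<integral>t. indicator {0..} t * f t \<partial>lborel)"
proof -
  have "(\<integral>z. f ((cmod z)\<^sup>2) \<partial>lborel) = (\<integral>t. f t \<partial>distr lborel borel (\<lambda>z. (cmod z)\<^sup>2))"
    by (rule integral_distr[symmetric]) auto
  also have "\<dots> = (\<integral>t. f t \<partial>density lborel (\<lambda>t. ennreal (pi * indicator {0..} t)))"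
    unfolding distr_lborel_cmod_power2 by (simp add: ennreal_mult' ennreal_indicator)
  also have "\<dots> = (\<integral>t. (pi * indicator {0..} t) * f t \<partial>lborel)"
    by (subst integral_density) auto
  finally show ?thesis by (simp add: mult.assoc)
qed

section \<open>The Vandermonde determinant\<close>

definition vandermonde_mat :: "nat \<Rightarrow> (nat \<Rightarrow> 'a :: comm_ring_1) \<Rightarrow> 'a mat" where
  "vandermonde_mat n x = mat n n (\<lambda>(i, j). x i ^ j)"

lemma vandermonde_mat_carrier [simp]: "vandermonde_mat n x \<in> carrier_mat n n"
  by (simp add: vandermonde_mat_def)

lemma det_vandermonde_mat_eq_0:
  assumes "i < n" "j < n" "i \<noteq> j" "x i = x j"
  shows "Determinant.det (vandermonde_mat n x) = 0"
proof (rule det_identical_rows[OF vandermonde_mat_carrier \<open>i \<noteq> j\<close>])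
  show "row (vandermonde_mat n x) i = row (vandermonde_mat n x) j"
    using assms by (intro eq_vecI) (simp_all add: vandermonde_mat_def)
qed fact+

text \<open>As a polynomial in the last node the determinant has degree at most \<open>n\<close>, the first
  \<open>n\<close> nodes as roots, and the smaller determinant as its coefficient of degree \<open>n\<close>.\<close>

lemma det_vandermonde_mat_Suc:
  fixes x :: "nat \<Rightarrow> 'a :: idom"
  shows "Determinant.det (vandermonde_mat (Suc n) x)
    = Determinant.det (vandermonde_mat n x) * (\<Prod>i<n. x n - x i)"
proof (cases "inj_on x {..<n}")
  \<comment> \<open>A repeated node among the first n ones gives two equal rows in both
    determinants, so both sides are 0.\<close>
  case False
  then obtain i j where ij: "i < n" "j < n" "i \<noteq> j" "x i = x j"
    by (auto simp: inj_on_def)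
  then show ?thesis
    using det_vandermonde_mat_eq_0[of i "Suc n" j x] det_vandermonde_mat_eq_0[of i n j x] by simp
next
  case True
  define D where "D y = Determinant.det (vandermonde_mat (Suc n) (x(n := y)))" for y
  define cf where "cf j = cofactor (vandermonde_mat (Suc n) x) n j" for j
  define p where "p = (\<Sum>j<Suc n. Polynomial.monom (cf j) j)"
  define q where "q = Polynomial.smult (cf n) (\<Prod>i<n. [:- x i, 1:])"
  have D: "D y = poly p y" for y
  proof -
    \<comment> \<open>Only row n depends on y and it is deleted here, so the cofactors along that
      row are constants and D is a polynomial in y.\<close>
    have "mat_delete (vandermonde_mat (Suc n) (x(n := y))) n j = mat_delete (vandermonde_mat (Suc n) x) n j" for j
      by (rule eq_matI) (auto simp: mat_delete_def vandermonde_mat_def)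
    then have c: "cofactor (vandermonde_mat (Suc n) (x(n := y))) n j = cf j" for j
      by (simp add: cf_def cofactor_def)
    have "D y = (\<Sum>j<Suc n. vandermonde_mat (Suc n) (x(n := y)) $$ (n, j) * cofactor (vandermonde_mat (Suc n) (x(n := y))) n j)"
      unfolding D_def by (rule laplace_expansion_row[OF vandermonde_mat_carrier]) simp
    also have "\<dots> = (\<Sum>j<Suc n. y ^ j * cf j)"
      unfolding c by (intro sum.cong) (auto simp: vandermonde_mat_def)
    also have "\<dots> = poly p y"
      by (simp add: p_def poly_sum poly_monom mult.commute del: sum.lessThan_Suc)
    finally show ?thesis .
  qed
  have "mat_delete (vandermonde_mat (Suc n) x) n n = vandermonde_mat n x"
    by (rule eq_matI) (auto simp: mat_delete_def vandermonde_mat_def)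
  then have cn: "cf n = Determinant.det (vandermonde_mat n x)"
    by (simp add: cf_def cofactor_def)
  have dq: "degree (\<Prod>i<n. [:- x i, 1:]) = n"
    by (subst degree_prod_eq_sum_degree) auto
  have lq: "lead_coeff (\<Prod>i<n. [:- x i, 1:]) = 1"
    by (simp add: lead_coeff_prod)
  have "p = q"
  proof (rule poly_eqI_degree_lead_coeff[where n = n and A = "x ` {..<n}"])
    have "poly.coeff p n = cf n"
      by (simp add: p_def coeff_sum)
    moreover have "poly.coeff q n = cf n"
      using dq lq by (simp add: q_def)
    ultimately show "poly.coeff p n = poly.coeff q n" by simp
    show "n \<le> card (x ` {..<n})"
      using True by (simp add: card_image)
    show "degree p \<le> n"
      unfolding p_def by (rule degree_sum_le) (auto intro: order_trans[OF degree_monom_le])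
    show "degree q \<le> n"
      unfolding q_def using dq by (metis degree_smult_le)
    fix z assume "z \<in> x ` {..<n}"
    then obtain i where i: "i < n" "z = x i" by auto
    have "D z = 0"
      unfolding D_def using i by (intro det_vandermonde_mat_eq_0[of i _ n]) auto
    moreover have "poly q z = 0"
      using i by (auto simp: q_def poly_prod)
    ultimately show "poly p z = poly q z"
      using D by simp
  qed
  then have "D (x n) = cf n * (\<Prod>i<n. x n - x i)"
    unfolding D by (simp add: q_def poly_prod)
  then show ?thesis
    by (simp add: D_def cn)
qed

text \<open>Passing to p + 1 adds exactly the pairs (i, p + 1), whose factors are those of
  \<open>det_vandermonde_mat_Suc\<close>. The eigenvalues are numbered from 1 and the rows from 0,
  hence \<open>z (Suc i)\<close>.\<close>

lemma prod_cmod_diff_eq_vandermonde: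
  "(\<Prod>(j, k)\<in>{(j, k). 1 \<le> j \<and> j < k \<and> k \<le> p}. (cmod (z j - z k))\<^sup>2)
    = (cmod (Determinant.det (vandermonde_mat p (\<lambda>i. z (Suc i)))))\<^sup>2"
proof (induction p)
  case 0
  have "{(j, k). 1 \<le> j \<and> j < k \<and> k \<le> (0::nat)} = {}" by auto
  moreover have "Determinant.det (vandermonde_mat 0 (\<lambda>i. z (Suc i))) = 1"
    using det_dim_zero[OF vandermonde_mat_carrier] by simp
  ultimately show ?case by (simp only: prod.empty) simp
next
  case (Suc p)
  let ?S = "\<lambda>p. {(j, k). 1 \<le> j \<and> j < k \<and> k \<le> p}"
  have S: "?S (Suc p) = ?S p \<union> (\<lambda>i. (Suc i, Suc p)) ` {..<p}"
  proof (intro equalityI subsetI)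
    fix x assume "x \<in> ?S (Suc p)"
    then obtain j k where x: "x = (j, k)" "1 \<le> j" "j < k" "k \<le> Suc p" by auto
    show "x \<in> ?S p \<union> (\<lambda>i. (Suc i, Suc p)) ` {..<p}"
    proof (cases "k = Suc p")
      case True
      then have "x = (Suc (j - 1), Suc p)" "j - 1 < p" using x by auto
      then show ?thesis by blast
    qed (use x in auto)
  qed auto
  have fin: "finite (?S p)"
    by (rule finite_subset[of _ "{..p} \<times> {..p}"]) auto
  have "(\<Prod>(j, k)\<in>?S (Suc p). (cmod (z j - z k))\<^sup>2)
    = (\<Prod>(j, k)\<in>?S p. (cmod (z j - z k))\<^sup>2) * (\<Prod>(j, k)\<in>(\<lambda>i. (Suc i, Suc p)) ` {..<p}. (cmod (z j - z k))\<^sup>2)"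
    unfolding S using fin by (intro prod.union_disjoint) auto
  also have "(\<Prod>(j, k)\<in>(\<lambda>i. (Suc i, Suc p)) ` {..<p}. (cmod (z j - z k))\<^sup>2) = (\<Prod>i<p. (cmod (z (Suc p) - z (Suc i)))\<^sup>2)"
    by (subst prod.reindex) (auto simp: inj_on_def norm_minus_commute)
  also have "\<dots> = (cmod (\<Prod>i<p. z (Suc p) - z (Suc i)))\<^sup>2"
    by (simp only: prod_norm[symmetric] prod_power_distrib)
  finally show ?case
    unfolding Suc.IH by (simp add: det_vandermonde_mat_Suc norm_mult power_mult_distrib)
qed

section \<open>Radial weights on the disc\<close>

text \<open>One factor of the weight in the eigenvalue density, cut off at the level r. The
  condition \<rho> < 1 copies the open polydisc, so that the density restricted to the event is a
  product of such weights at every point, also for l = 0.\<close>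

definition disc_weight :: "nat \<Rightarrow> real \<Rightarrow> real \<Rightarrow> real" where
  "disc_weight l r \<rho> = (if \<rho> < 1 \<and> \<rho> \<le> r then (1 - \<rho>\<^sup>2) ^ l else 0)"

lemma disc_weight_nonneg: "0 \<le> \<rho> \<Longrightarrow> 0 \<le> disc_weight l r \<rho>"
  by (simp add: disc_weight_def power_le_one)

lemma disc_weight_measurable [measurable]: "disc_weight l r \<in> borel_measurable borel"
  unfolding disc_weight_def by measurable

lemma integrable_disc_monomial:
  "integrable lborel (\<lambda>z. z ^ a * cnj z ^ b * complex_of_real (disc_weight l r (cmod z)))"
proof (rule integrableI_bounded_set[where A = "ball 0 1" and B = 1])
  show "emeasure lborel (ball (0::complex) 1) < \<infinity>"
    by (simp add: emeasure_ball)
  have "(\<lambda>z::complex. z ^ a * cnj z ^ b * complex_of_real (disc_weight l r (cmod z))) \<in> borel_measurable borel"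
  proof -
    have [measurable]: "cnj \<in> borel_measurable borel"
      by (intro borel_measurable_continuous_onI continuous_intros)
    show ?thesis by measurable
  qed
  then show "(\<lambda>z::complex. z ^ a * cnj z ^ b * complex_of_real (disc_weight l r (cmod z))) \<in> borel_measurable lborel"
    by simp
  show "AE z in lborel. z \<in> ball 0 1 \<longrightarrow> cmod (z ^ a * cnj z ^ b * complex_of_real (disc_weight l r (cmod z))) \<le> 1"
  proof (intro AE_I2 impI)
    fix z :: complex assume "z \<in> ball 0 1"
    then have z: "cmod z < 1" by (simp add: dist_norm)
    then have "0 \<le> 1 - (cmod z)\<^sup>2" "1 - (cmod z)\<^sup>2 \<le> 1"
      by (simp_all add: power_le_one)
    then have "\<bar>disc_weight l r (cmod z)\<bar> \<le> 1"
      by (auto simp: disc_weight_def power_le_one)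
    then have "cmod z ^ a * cmod z ^ b * \<bar>disc_weight l r (cmod z)\<bar> \<le> 1 * 1 * 1"
      using z by (intro mult_mono power_le_one mult_nonneg_nonneg) auto
    then show "cmod (z ^ a * cnj z ^ b * complex_of_real (disc_weight l r (cmod z))) \<le> 1"
      by (simp add: norm_mult norm_power)
  qed
  show "AE z in lborel. z \<notin> ball 0 1 \<longrightarrow> z ^ a * cnj z ^ b * complex_of_real (disc_weight l r (cmod z)) = 0"
    by (auto simp: disc_weight_def dist_norm)
qed auto

text \<open>The squared norm of z^k for the weight \<open>disc_weight l r\<close>. The factor before
  the last parenthesis is its value for r = 1; the parenthesis is the only part that depends on
  r.\<close>

definition disc_moment :: "nat \<Rightarrow> real \<Rightarrow> nat \<Rightarrow> real" where
  "disc_moment l r k = pi * (fact k * fact l / fact (k + l + 1)) * (1 - beta_tail k l (r\<^sup>2))"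

lemma integral_beta_lower:
  assumes "0 \<le> x" "x \<le> 1"
  shows "(LBINT t. indicator {0..} t * (if t < 1 \<and> t \<le> x then t ^ k * (1 - t) ^ l else 0))
    = fact k * fact l / fact (k + l + 1) * (1 - beta_tail k l x)"
proof -
  have "(LBINT t. indicator {0..} t * (if t < 1 \<and> t \<le> x then t ^ k * (1 - t) ^ l else 0))
     = (LBINT t:{0..x}. t ^ k * (1 - t) ^ l)"
    unfolding set_lebesgue_integral_def
  proof (rule integral_cong_AE)
    show "AE t in lborel. indicator {0..} t * (if t < 1 \<and> t \<le> x then t ^ k * (1 - t) ^ l else 0)
        = indicator {0..x} t *\<^sub>R (t ^ k * (1 - t) ^ l)"
      \<comment> \<open>The two integrands can differ only at t = 1, when x = 1, and this is a null
        set.\<close>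
      using AE_lborel_singleton[of 1]
    proof eventually_elim
      case (elim t)
      then have "t < 1 \<and> t \<le> x \<longleftrightarrow> t \<le> x" using assms by linarith
      then show ?case by (simp add: indicator_def)
    qed
  qed measurable
  also have "\<dots> = integral {0..x} (\<lambda>t. t ^ k * (1 - t) ^ l)"
    by (intro set_borel_integral_eq_integral borel_integrable_atLeastAtMost') (intro continuous_intros)
  also have "\<dots> = integral {0..1} (\<lambda>t. t ^ k * (1 - t) ^ l) - integral {x..1} (\<lambda>t. t ^ k * (1 - t) ^ l)"
  proof -
    have "(\<lambda>t::real. t ^ k * (1 - t) ^ l) integrable_on {0..1}"
      by (intro integrable_continuous_interval continuous_intros)
    from Henstock_Kurzweil_Integration.integral_combine[OF assms this] show ?thesis by simp
  qed
  also have "\<dots> = fact k * fact l / fact (k + l + 1) * (beta_tail k l 0 - beta_tail k l x)"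
    by (simp add: beta_tail_def beta_integral_def right_diff_distrib)
  finally show ?thesis by (simp only: beta_tail_0)
qed

lemma integral_disc_monomial:
  assumes "0 \<le> r" "r \<le> 1"
  shows "(LBINT z. z ^ a * cnj z ^ b * complex_of_real (disc_weight l r (cmod z)))
    = (if a = b then complex_of_real (disc_moment l r a) else 0)"
proof (cases "a = b")
  case True
  define f where "f t = (if t < 1 \<and> t \<le> r\<^sup>2 then t ^ a * (1 - t) ^ l else 0)" for t :: real
  have [measurable]: "f \<in> borel_measurable borel" unfolding f_def by measurable
  have "z ^ a * cnj z ^ b * complex_of_real (disc_weight l r (cmod z)) = complex_of_real (f ((cmod z)\<^sup>2))" for z
  proof -
    have "z ^ a * cnj z ^ b = complex_of_real (((cmod z)\<^sup>2) ^ a)"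
      by (simp add: True power_mult_distrib[symmetric] complex_norm_square[symmetric] del: of_real_power) (simp add: complex_norm_square)
    moreover have "cmod z < 1 \<longleftrightarrow> (cmod z)\<^sup>2 < 1"
      by (metis abs_norm_cancel abs_square_less_1)
    moreover have "cmod z \<le> r \<longleftrightarrow> (cmod z)\<^sup>2 \<le> r\<^sup>2"
      using assms by (simp add: power2_le_iff_abs_le)
    ultimately show ?thesis
      by (simp add: f_def disc_weight_def)
  qed
  then have "(LBINT z. z ^ a * cnj z ^ b * complex_of_real (disc_weight l r (cmod z)))
    = complex_of_real (LBINT z. f ((cmod z)\<^sup>2))"
    by simp
  also have "(LBINT z. f ((cmod z)\<^sup>2)) = disc_moment l r a"
  proof -
    have "(LBINT t. indicator {0..} t * f t) = fact a * fact l / fact (a + l + 1) * (1 - beta_tail a l (r\<^sup>2))"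
      unfolding f_def using assms by (intro integral_beta_lower) (auto simp: power_le_one)
    then show ?thesis
      by (simp add: integral_radial disc_moment_def)
  qed
  finally show ?thesis using True by simp
next
  case False
  then show ?thesis by (simp add: integral_monomial_radial_orthogonal)
qed

text \<open>Andreief's identity: by orthogonality only the diagonal terms of the double sum over
  permutations survive.\<close>

lemma nn_integral_vandermonde_disc:
  assumes r: "0 \<le> r" "r \<le> 1"
  shows "(\<integral>\<^sup>+ x. ennreal ((\<Prod>(j, k)\<in>{(j, k). 1 \<le> j \<and> j < k \<and> k \<le> p}. (cmod (x j - x k))\<^sup>2)
        * (\<Prod>j\<in>{1..p}. disc_weight l r (cmod (x j)))) \<partial>(\<Pi>\<^sub>M i\<in>{1..p}. (lborel :: complex measure)))
    = ennreal (fact p * (\<Prod>k<p. disc_moment l r k))"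
proof -
  interpret product_sigma_finite "\<lambda>_::nat. lborel :: complex measure" by standard
  let ?M = "\<Pi>\<^sub>M i\<in>{1..p}. (lborel :: complex measure)"
  let ?S = "{\<pi>. \<pi> permutes {0..<p}}"
  define h where "h a b z = z ^ a * cnj z ^ b * complex_of_real (disc_weight l r (cmod z))" for a b z
  \<comment> \<open>The contribution of one pair of permutations to the expanded product V * cnj V.
    It factorises over the coordinates, so its integral over the product space is a product of
    planar integrals.\<close>
  define T where "T \<sigma> \<tau> x = (\<Prod>j\<in>{1..p}. h (\<sigma> (j - 1)) (\<tau> (j - 1)) (x j))" for \<sigma> \<tau> x
  define R where "R x = (\<Prod>(j, k)\<in>{(j, k). 1 \<le> j \<and> j < k \<and> k \<le> p}. (cmod (x j - x k))\<^sup>2)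
        * (\<Prod>j\<in>{1..p}. disc_weight l r (cmod (x j)))" for x
  have finS: "finite ?S" by (simp add: finite_permutations)
  have hI: "integrable lborel (h a b)" for a b
    unfolding h_def by (rule integrable_disc_monomial)
  have TI: "integrable ?M (T \<sigma> \<tau>)" for \<sigma> \<tau>
    unfolding T_def by (intro product_integrable_prod hI) simp
  have Tint: "(\<integral>x. T \<sigma> \<tau> x \<partial>?M) = (if \<sigma> = \<tau> then complex_of_real (\<Prod>k<p. disc_moment l r k) else 0)"
    if "\<sigma> \<in> ?S" "\<tau> \<in> ?S" for \<sigma> \<tau>
  proof -
    have "(\<integral>x. T \<sigma> \<tau> x \<partial>?M) = (\<Prod>j\<in>{1..p}. LBINT z. h (\<sigma> (j - 1)) (\<tau> (j - 1)) z)"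
      unfolding T_def by (intro product_integral_prod hI) simp
    also have "\<dots> = (\<Prod>i<p. LBINT z. h (\<sigma> i) (\<tau> i) z)"
      by (simp add: prod.atLeast1_atMost_eq)
    also have "\<dots> = (\<Prod>i<p. if \<sigma> i = \<tau> i then complex_of_real (disc_moment l r (\<sigma> i)) else 0)"
      unfolding h_def by (simp only: integral_disc_monomial[OF r])
    also have "\<dots> = (if \<sigma> = \<tau> then complex_of_real (\<Prod>k<p. disc_moment l r k) else 0)"
    proof (cases "\<sigma> = \<tau>")
      case True
      have "(\<Prod>k<p. disc_moment l r k) = (\<Prod>i<p. disc_moment l r (\<sigma> i))"
        using prod.permute[of \<sigma> "{0..<p}" "disc_moment l r"] that by (simp add: atLeast0LessThan)
      then show ?thesis using True by simp
    next
      case False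
      then obtain i where "\<sigma> i \<noteq> \<tau> i" by blast
      moreover from this have "i < p"
        using that by (metis atLeast0LessThan lessThan_iff mem_Collect_eq permutes_not_in)
      ultimately show ?thesis using False by (auto intro!: prod_zero)
    qed
    finally show ?thesis .
  qed
  have RT: "complex_of_real (R x) = (\<Sum>\<sigma>\<in>?S. \<Sum>\<tau>\<in>?S. (signof \<sigma> * signof \<tau>) * T \<sigma> \<tau> x)" for x
  proof -
    define V where "V = Determinant.det (vandermonde_mat p (\<lambda>i. x (Suc i)))"
    have V: "V = (\<Sum>\<sigma>\<in>?S. signof \<sigma> * (\<Prod>i<p. x (Suc i) ^ \<sigma> i))"
      unfolding V_def det_def'[OF vandermonde_mat_carrier]
      by (intro sum.cong refl arg_cong2[of _ _ _ _ "(*)"] prod.cong)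
        (auto simp: vandermonde_mat_def atLeast0LessThan dest: permutes_in_image)
    have "cnj (signof \<sigma>) = signof \<sigma>" for \<sigma> :: "nat \<Rightarrow> nat"
      by (simp add: sign_def)
    then have V': "cnj V = (\<Sum>\<tau>\<in>?S. signof \<tau> * (\<Prod>i<p. cnj (x (Suc i)) ^ \<tau> i))"
      unfolding V by simp
    have "complex_of_real (R x) = V * cnj V * (\<Prod>i<p. complex_of_real (disc_weight l r (cmod (x (Suc i)))))"
      unfolding R_def prod_cmod_diff_eq_vandermonde V_def[symmetric]
      by (simp only: of_real_mult of_real_prod complex_norm_square One_nat_def prod.atLeast1_atMost_eq)
    also have "\<dots> = (\<Sum>\<sigma>\<in>?S. signof \<sigma> * (\<Prod>i<p. x (Suc i) ^ \<sigma> i))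
        * (\<Sum>\<tau>\<in>?S. signof \<tau> * (\<Prod>i<p. cnj (x (Suc i)) ^ \<tau> i))
        * (\<Prod>i<p. complex_of_real (disc_weight l r (cmod (x (Suc i)))))"
      by (intro arg_cong2[of _ _ _ _ "(*)"] V V' refl)
    also have "\<dots> = (\<Sum>\<sigma>\<in>?S. \<Sum>\<tau>\<in>?S. signof \<sigma> * (\<Prod>i<p. x (Suc i) ^ \<sigma> i)
        * (signof \<tau> * (\<Prod>i<p. cnj (x (Suc i)) ^ \<tau> i)) * (\<Prod>i<p. complex_of_real (disc_weight l r (cmod (x (Suc i))))))"
      by (subst sum_product) (simp only: sum_distrib_right)
    also have "\<dots> = (\<Sum>\<sigma>\<in>?S. \<Sum>\<tau>\<in>?S. (signof \<sigma> * signof \<tau>) * T \<sigma> \<tau> x)"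
      by (intro sum.cong refl) (simp add: T_def h_def prod.atLeast1_atMost_eq prod.distrib mult_ac)
    finally show ?thesis .
  qed
  have RI: "integrable ?M (\<lambda>x. complex_of_real (R x))"
    unfolding RT by (intro Bochner_Integration.integrable_sum integrable_mult_right TI)
  have "complex_of_real (\<integral>x. R x \<partial>?M) = (\<integral>x. complex_of_real (R x) \<partial>?M)"
    by simp
  also have "\<dots> = (\<Sum>\<sigma>\<in>?S. \<Sum>\<tau>\<in>?S. (signof \<sigma> * signof \<tau>) * (\<integral>x. T \<sigma> \<tau> x \<partial>?M))"
  proof -
    have "(\<integral>x. complex_of_real (R x) \<partial>?M)
      = (\<Sum>\<sigma>\<in>?S. \<integral>x. (\<Sum>\<tau>\<in>?S. (signof \<sigma> * signof \<tau>) * T \<sigma> \<tau> x) \<partial>?M)"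
      unfolding RT by (intro Bochner_Integration.integral_sum Bochner_Integration.integrable_sum integrable_mult_right TI)
    also have "\<dots> = (\<Sum>\<sigma>\<in>?S. \<Sum>\<tau>\<in>?S. \<integral>x. (signof \<sigma> * signof \<tau>) * T \<sigma> \<tau> x \<partial>?M)"
      by (intro sum.cong refl Bochner_Integration.integral_sum integrable_mult_right TI)
    finally show ?thesis by simp
  qed
  \<comment> \<open>On the diagonal the squared sign is 1, and every permutation contributes the
    same product of moments; this produces the factor p!.\<close>
  also have "\<dots> = (\<Sum>\<sigma>\<in>?S. \<Sum>\<tau>\<in>?S. if \<sigma> = \<tau> then complex_of_real (\<Prod>k<p. disc_moment l r k) else 0)"
    by (intro sum.cong refl) (simp only: Tint, simp add: sign_def)
  also have "\<dots> = (\<Sum>\<sigma>\<in>?S. complex_of_real (\<Prod>k<p. disc_moment l r k))"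
    using finS by (intro sum.cong refl) (simp add: sum.delta')
  also have "\<dots> = complex_of_real (fact p * (\<Prod>k<p. disc_moment l r k))"
    by (simp add: card_permutations)
  finally have eq: "(\<integral>x. R x \<partial>?M) = fact p * (\<Prod>k<p. disc_moment l r k)"
    by (simp only: of_real_eq_iff)
  have "(\<integral>\<^sup>+ x. ennreal (R x) \<partial>?M) = ennreal (\<integral>x. R x \<partial>?M)"
  proof (rule nn_integral_eq_integral)
    show "integrable ?M R"
      using RI by (simp add: complex_of_real_integrable_eq)
    show "AE x in ?M. 0 \<le> R x"
      unfolding R_def by (intro AE_I2 mult_nonneg_nonneg prod_nonneg) (auto intro: disc_weight_nonneg)
  qed
  then show ?thesis
    unfolding eq by (simp only: R_def)
qed

lemma beta_tail_le_1:
  assumes "0 \<le> x" "x \<le> 1"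
  shows "beta_tail k l x \<le> 1"
proof -
  have "beta_integral k l x \<le> beta_integral k l 0"
    unfolding beta_integral_def using assms
    by (intro integral_subset_le integrable_continuous_interval continuous_intros) auto
  then have "beta_tail k l x \<le> beta_tail k l 0"
    unfolding beta_tail_def by (intro mult_left_mono) auto
  then show ?thesis by (simp only: beta_tail_0)
qed

lemma beta_tail_1: "beta_tail k l 1 = 0"
  by (simp add: beta_tail_def beta_integral_def)

text \<open>Separating \<open>C\<close> needs no sign of \<open>C\<close>: the remaining factor is
  nonnegative, and \<open>ennreal\<close> sends a negative \<open>C\<close> to 0 on both
  sides.\<close>

lemma truncated_unitary_density_disc:
  assumes "x \<in> A"
  shows "ennreal (truncated_unitary_density C n p x) * indicator {x \<in> A. \<forall>j\<in>{1..p}. cmod (x j) \<le> r} x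
    = ennreal C * ennreal ((\<Prod>(j, k)\<in>{(j, k). 1 \<le> j \<and> j < k \<and> k \<le> p}. (cmod (x j - x k))\<^sup>2)
        * (\<Prod>j\<in>{1..p}. disc_weight (n - p - 1) r (cmod (x j))))"
proof (cases "\<forall>j\<in>{1..p}. cmod (x j) < 1 \<and> cmod (x j) \<le> r")
  case True
  then have eq: "(\<Prod>j\<in>{1..p}. disc_weight (n - p - 1) r (cmod (x j))) = (\<Prod>j\<in>{1..p}. (1 - (cmod (x j))\<^sup>2) ^ (n - p - 1))"
    by (intro prod.cong) (auto simp: disc_weight_def)
  have "0 \<le> (\<Prod>j\<in>{1..p}. disc_weight (n - p - 1) r (cmod (x j)))"
    by (intro prod_nonneg) (auto intro: disc_weight_nonneg)
  moreover have "0 \<le> (\<Prod>(j, k)\<in>{(j, k). 1 \<le> j \<and> j < k \<and> k \<le> p}. (cmod (x j - x k))\<^sup>2)"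
    by (intro prod_nonneg) auto
  moreover have "truncated_unitary_density C n p x = C * ((\<Prod>(j, k)\<in>{(j, k). 1 \<le> j \<and> j < k \<and> k \<le> p}. (cmod (x j - x k))\<^sup>2)
        * (\<Prod>j\<in>{1..p}. disc_weight (n - p - 1) r (cmod (x j))))"
    using True unfolding eq truncated_unitary_density_def by (simp add: mult.assoc)
  moreover have "indicator {x \<in> A. \<forall>j\<in>{1..p}. cmod (x j) \<le> r} x = (1 :: ennreal)"
    using True assms by simp
  ultimately show ?thesis
    by (simp only: ennreal_mult'' mult_nonneg_nonneg mult_1_right)
next
  case False
  then obtain j where "j \<in> {1..p}" "\<not> (cmod (x j) < 1 \<and> cmod (x j) \<le> r)" by blast
  then have "(\<Prod>j\<in>{1..p}. disc_weight (n - p - 1) r (cmod (x j))) = 0"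
    by (intro prod_zero) (auto simp: disc_weight_def intro!: bexI[of _ j])
  moreover have "truncated_unitary_density C n p x = 0 \<or> x \<notin> {x \<in> A. \<forall>j\<in>{1..p}. cmod (x j) \<le> r}"
    using False by (auto simp: truncated_unitary_density_def)
  then have "ennreal (truncated_unitary_density C n p x) * indicator {x \<in> A. \<forall>j\<in>{1..p}. cmod (x j) \<le> r} x = 0"
    by (elim disjE) (simp_all only: ennreal_0 mult_zero_left mult_zero_right indicator_def if_False of_bool_eq)
  ultimately show ?thesis by (simp only: mult_zero_right ennreal_0)
qed

text \<open>Kostlan's phenomenon: for the maximum, the squared moduli behave like independent Beta
  variables with first parameters 1, ..., p. Every level s gives the same constant times the
  product, and the level 1 shows that this constant is 1.\<close>

lemma prob_all_eigenvalues_le: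
  assumes "prob_space M"
    and dens: "unordered_joint_density M {1..p} z (truncated_unitary_density C n p)"
    and r: "0 \<le> r" "r \<le> 1"
  shows "measure M {\<omega>\<in>space M. \<forall>j\<in>{1..p}. cmod (z j \<omega>) \<le> r} = (\<Prod>k<p. 1 - beta_tail k (n - p - 1) (r\<^sup>2))"
proof -
  interpret prob_space M by fact
  define l where "l = n - p - 1"
  let ?P = "\<Pi>\<^sub>M i\<in>{1..p}. (lborel :: complex measure)"
  define S where "S r = {x \<in> space ?P. \<forall>j\<in>{1..p}. cmod (x j) \<le> r}" for r
  define Z where "Z = fact p * (\<Prod>k<p. pi * (fact k * fact l / fact (k + l + 1)))"
  have Z: "Z \<ge> 0" unfolding Z_def by (intro mult_nonneg_nonneg prod_nonneg) auto
  \<comment> \<open>Permutation invariance of the event is what allows the unordered density to be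
    used. Outside the index set a permutation is the identity, so extensionality is preserved as
    well.\<close>
  have sym: "S s \<in> sets ?P \<and> (\<forall>\<pi>. \<pi> permutes {1..p} \<longrightarrow> (\<forall>x\<in>S s. x \<circ> \<pi> \<in> S s))" for s
  proof -
    have "S s \<in> sets ?P" unfolding S_def by measurable
    moreover have "x \<circ> \<pi> \<in> S s" if "\<pi> permutes {1..p}" "x \<in> S s" for \<pi> x
    proof -
      have "x (\<pi> j) = undefined" if "j \<notin> {1..p}" for j
        using permutes_not_in[OF \<open>\<pi> permutes {1..p}\<close> that] \<open>x \<in> S s\<close> that
        by (auto simp: S_def space_PiM PiE_def extensional_def)
      moreover have "\<pi> j \<in> {1..p}" if "j \<in> {1..p}" for j
        using permutes_in_image[OF \<open>\<pi> permutes {1..p}\<close>] that by blast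
      ultimately show ?thesis
        using \<open>x \<in> S s\<close> by (simp add: S_def space_PiM PiE_def extensional_def)
    qed
    ultimately show ?thesis by blast
  qed
  have dens_S: "emeasure M {\<omega>\<in>space M. (\<lambda>i\<in>{1..p}. z i \<omega>) \<in> S s}
          = (\<integral>\<^sup>+ x. ennreal (truncated_unitary_density C n p x) * indicator (S s) x \<partial>?P)" for s
    using dens sym[of s] unfolding unordered_joint_density_def by blast
  have S_iff: "{\<omega>\<in>space M. (\<lambda>i\<in>{1..p}. z i \<omega>) \<in> S s} = {\<omega>\<in>space M. \<forall>j\<in>{1..p}. cmod (z j \<omega>) \<le> s}" for s
    by (auto simp: S_def space_PiM)
  have ev: "emeasure M {\<omega>\<in>space M. \<forall>j\<in>{1..p}. cmod (z j \<omega>) \<le> s} = ennreal C * ennreal Z * ennreal (\<Prod>k<p. 1 - beta_tail k l (s\<^sup>2))"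
    if s: "0 \<le> s" "s \<le> 1" for s
  proof -
    have "emeasure M {\<omega>\<in>space M. \<forall>j\<in>{1..p}. cmod (z j \<omega>) \<le> s}
          = (\<integral>\<^sup>+ x. ennreal (truncated_unitary_density C n p x) * indicator (S s) x \<partial>?P)"
      using dens_S[of s] by (simp only: S_iff)
    also have "\<dots> = (\<integral>\<^sup>+ x. ennreal C * ennreal ((\<Prod>(j, k)\<in>{(j, k). 1 \<le> j \<and> j < k \<and> k \<le> p}. (cmod (x j - x k))\<^sup>2)
        * (\<Prod>j\<in>{1..p}. disc_weight l s (cmod (x j)))) \<partial>?P)"
      unfolding S_def l_def by (intro nn_integral_cong truncated_unitary_density_disc)
    also have "\<dots> = ennreal C * ennreal (fact p * (\<Prod>k<p. disc_moment l s k))"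
    proof (subst nn_integral_cmult)
      have "(\<lambda>x. \<Prod>(j, k)\<in>{(j, k). 1 \<le> j \<and> j < k \<and> k \<le> p}. (cmod (x j - x k))\<^sup>2) \<in> borel_measurable ?P"
        unfolding case_prod_beta
        by (intro borel_measurable_prod borel_measurable_power borel_measurable_norm borel_measurable_diff
            measurable_component_singleton[THEN measurable_compose, of _ _ _ "\<lambda>x. x"]) auto
      moreover have "(\<lambda>x. \<Prod>j\<in>{1..p}. disc_weight l s (cmod (x j))) \<in> borel_measurable ?P"
        by measurable
      ultimately show "(\<lambda>x. ennreal ((\<Prod>(j, k)\<in>{(j, k). 1 \<le> j \<and> j < k \<and> k \<le> p}. (cmod (x j - x k))\<^sup>2)
        * (\<Prod>j\<in>{1..p}. disc_weight l s (cmod (x j))))) \<in> borel_measurable ?P"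
        by measurable
    qed (simp only: nn_integral_vandermonde_disc[OF s])
    also have "fact p * (\<Prod>k<p. disc_moment l s k) = Z * (\<Prod>k<p. 1 - beta_tail k l (s\<^sup>2))"
      by (simp only: Z_def disc_moment_def prod.distrib mult.assoc)
    finally show ?thesis
      using Z by (simp add: ennreal_mult' mult.assoc)
  qed
  \<comment> \<open>The density vanishes off the open polydisc, so the whole space and the event at
    level 1 receive the same mass, which is 1.\<close>
  have "ennreal C * ennreal Z = 1"
  proof -
    have "emeasure M {\<omega>\<in>space M. (\<lambda>i\<in>{1..p}. z i \<omega>) \<in> space ?P}
          = (\<integral>\<^sup>+ x. ennreal (truncated_unitary_density C n p x) * indicator (space ?P) x \<partial>?P)"
    proof -
      have "x \<circ> \<pi> \<in> space ?P" if "\<pi> permutes {1..p}" "x \<in> space ?P" for \<pi> x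
        using that permutes_not_in[OF that(1)] by (auto simp: space_PiM PiE_def extensional_def)
      then show ?thesis
        using dens sets.top[of ?P] unfolding unordered_joint_density_def by blast
    qed
    also have "\<dots> = (\<integral>\<^sup>+ x. ennreal (truncated_unitary_density C n p x) * indicator (S 1) x \<partial>?P)"
      by (intro nn_integral_cong) (auto simp: S_def truncated_unitary_density_def indicator_def less_imp_le)
    also have "\<dots> = emeasure M {\<omega>\<in>space M. \<forall>j\<in>{1..p}. cmod (z j \<omega>) \<le> 1}"
      using dens_S[of 1] by (simp only: S_iff)
    also have "\<dots> = ennreal C * ennreal Z"
      using ev[OF zero_le_one order_refl]
      by (simp only: power_one beta_tail_1 diff_zero prod.neutral_const ennreal_1 mult_1_right)
    also have "{\<omega>\<in>space M. (\<lambda>i\<in>{1..p}. z i \<omega>) \<in> space ?P} = space M"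
      by (auto simp: space_PiM)
    finally show ?thesis by (simp add: emeasure_space_1)
  qed
  then have "emeasure M {\<omega>\<in>space M. \<forall>j\<in>{1..p}. cmod (z j \<omega>) \<le> r} = ennreal (\<Prod>k<p. 1 - beta_tail k l (r\<^sup>2))"
    using ev[OF r] by simp
  moreover have "0 \<le> (\<Prod>k<p. 1 - beta_tail k l (r\<^sup>2))"
    using r by (intro prod_nonneg) (simp add: beta_tail_le_1 power_le_one)
  ultimately show ?thesis
    by (simp add: measure_def l_def)
qed

section \<open>Laplace's method for the Beta weight\<close>

lemma integral_linear_exp:
  fixes E :: real
  assumes "E > 0" "T \<ge> 0"
  shows "((\<lambda>s. (s - x) * exp (- E * (s - x))) has_integral (1 - (1 + E * T) * exp (- E * T)) / E\<^sup>2) {x..x + T}"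
proof -
  define F where "F s = - ((1 + E * (s - x)) * exp (- E * (s - x)) / E\<^sup>2)" for s
  have "((\<lambda>s. (s - x) * exp (- E * (s - x))) has_integral (F (x + T) - F x)) {x..x + T}"
  proof (rule fundamental_theorem_of_calculus)
    fix s :: real
    have "((\<lambda>s. (1 + E * (s - x)) * exp (- E * (s - x))) has_real_derivative - (E\<^sup>2 * ((s - x) * exp (- E * (s - x)))))
        (at s within {x..x + T})"
      by (rule derivative_eq_intros refl)+ (simp add: algebra_simps power2_eq_square)
    from DERIV_cmult[OF this, of "- 1 / E\<^sup>2"]
    have "(F has_real_derivative (s - x) * exp (- E * (s - x))) (at s within {x..x + T})"
      using assms by (simp add: F_def[abs_def])
    then show "(F has_vector_derivative (s - x) * exp (- E * (s - x))) (at s within {x..x + T})"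
      by (simp add: has_real_derivative_iff_has_vector_derivative)
  qed (use assms in simp)
  moreover have "F (x + T) - F x = (1 - (1 + E * T) * exp (- E * T)) / E\<^sup>2"
    by (simp add: F_def diff_divide_distrib)
  ultimately show ?thesis by simp
qed

lemma exp_power_eq: "exp (real n * a) = exp a ^ n"
  by (simp add: exp_of_nat_mult)

text \<open>First-order upper and second-order lower bounds for q * ln(1 + a). For a > 1 the
  exponent of the lower bound is negative and the claim is trivial.\<close>

lemma one_plus_power_bounds:
  fixes a :: real
  assumes "a \<ge> 0"
  shows "(1 + a) ^ q \<le> exp (real q * a)" and "exp (real q * (a - a\<^sup>2)) \<le> (1 + a) ^ q"
proof -
  show "(1 + a) ^ q \<le> exp (real q * a)"
    unfolding exp_power_eq using assms by (intro power_mono) auto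
  have "exp (a - a\<^sup>2) \<le> 1 + a"
  proof (cases "a \<le> 1")
    case True
    then have "a - a\<^sup>2 \<le> ln (1 + a)"
      using assms by (intro ln_one_plus_pos_lower_bound)
    then show ?thesis using assms by (simp add: ln_ge_iff)
  next
    case False
    then have "a - a\<^sup>2 \<le> 0" by (simp add: power2_eq_square)
    then have "exp (a - a\<^sup>2) \<le> 1" by simp
    then show ?thesis using assms by linarith
  qed
  then show "exp (real q * (a - a\<^sup>2)) \<le> (1 + a) ^ q"
    unfolding exp_power_eq by (intro power_mono) auto
qed

lemma one_minus_power_bounds:
  fixes b :: real
  assumes "0 \<le> b"
  shows "b \<le> 1 \<Longrightarrow> (1 - b) ^ l \<le> exp (- (real l * b))"
    and "b \<le> 1 / 2 \<Longrightarrow> exp (- (real l * (b + 2 * b\<^sup>2))) \<le> (1 - b) ^ l"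
proof -
  have e: "exp (- (real l * c)) = exp (- c) ^ l" for c
    using exp_power_eq[of l "- c"] by simp
  show "(1 - b) ^ l \<le> exp (- (real l * b))" if "b \<le> 1"
    unfolding e using that exp_ge_add_one_self[of "- b"] by (intro power_mono) auto
  show "exp (- (real l * (b + 2 * b\<^sup>2))) \<le> (1 - b) ^ l" if "b \<le> 1 / 2"
  proof -
    have "- b - 2 * b\<^sup>2 \<le> ln (1 - b)"
      using assms that by (intro ln_one_minus_pos_lower_bound)
    then have "exp (- (b + 2 * b\<^sup>2)) \<le> 1 - b"
      using assms that by (simp add: ln_ge_iff)
    then show ?thesis unfolding e by (intro power_mono) auto
  qed
qed

lemma beta_weight_factor:
  fixes x s :: real
  assumes "0 < x" "x < 1"
  shows "s ^ q * (1 - s) ^ l = x ^ q * (1 - x) ^ l * ((1 + (s - x) / x) ^ q * (1 - (s - x) / (1 - x)) ^ l)"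
proof -
  have "s = x * (1 + (s - x) / x)" "1 - s = (1 - x) * (1 - (s - x) / (1 - x))"
    using assms by (simp_all add: field_simps)
  then have "s ^ q = x ^ q * (1 + (s - x) / x) ^ q" "(1 - s) ^ l = (1 - x) ^ l * (1 - (s - x) / (1 - x)) ^ l"
    by (metis power_mult_distrib)+
  then show ?thesis by simp
qed

text \<open>E is minus the logarithmic derivative of s^q (1-s)^l at x. By concavity of the logarithm
  the weight lies below its tangent exponential, and the integral of u * exp(-E u) over the
  half-line is 1/E^2.\<close>

lemma beta_excess_le:
  fixes x :: real
  assumes x: "0 < x" "x < 1" and E: "E = real l / (1 - x) - real q / x" "E > 0"
  shows "integral {x..1} (\<lambda>s. (s - x) * (s ^ q * (1 - s) ^ l)) \<le> x ^ q * (1 - x) ^ l / E\<^sup>2"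
proof -
  define w where "w = x ^ q * (1 - x) ^ l"
  have w: "w \<ge> 0" using x by (simp add: w_def)
  have I: "((\<lambda>s. (s - x) * exp (- E * (s - x))) has_integral (1 - (1 + E * (1 - x)) * exp (- E * (1 - x))) / E\<^sup>2) {x..1}"
    using integral_linear_exp[OF \<open>E > 0\<close>, of "1 - x" x] x by simp
  have "integral {x..1} (\<lambda>s. (s - x) * (s ^ q * (1 - s) ^ l)) \<le> integral {x..1} (\<lambda>s. w * ((s - x) * exp (- E * (s - x))))"
  proof (rule integral_le)
    fix s assume s: "s \<in> {x..1}"
    have "(1 + (s - x) / x) ^ q * (1 - (s - x) / (1 - x)) ^ l \<le> exp (real q * ((s - x) / x)) * exp (- (real l * ((s - x) / (1 - x))))"
      using s x by (intro mult_mono one_plus_power_bounds one_minus_power_bounds zero_le_power) (auto simp: field_simps)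
    also have "\<dots> = exp (- E * (s - x))"
      unfolding exp_add[symmetric] E(1) by (simp add: algebra_simps)
    finally have "s ^ q * (1 - s) ^ l \<le> w * exp (- E * (s - x))"
      unfolding beta_weight_factor[OF x, of s] w_def[symmetric] using w by (intro mult_left_mono)
    then have "(s - x) * (s ^ q * (1 - s) ^ l) \<le> (s - x) * (w * exp (- E * (s - x)))"
      using s by (intro mult_left_mono) auto
    then show "(s - x) * (s ^ q * (1 - s) ^ l) \<le> w * ((s - x) * exp (- E * (s - x)))"
      by (simp add: mult.left_commute)
  qed (intro integrable_continuous_interval continuous_intros)+
  also have "\<dots> = w * ((1 - (1 + E * (1 - x)) * exp (- E * (1 - x))) / E\<^sup>2)"
    using I by (simp add: integral_unique)
  also have "\<dots> \<le> w * (1 / E\<^sup>2)"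
    using w x E(2) by (intro mult_left_mono divide_right_mono) auto
  finally show ?thesis by (simp add: w_def)
qed

text \<open>The integral is restricted to a window of K decay lengths 1/E to the right of x, on
  which the second-order terms of the logarithm cost at most the first exponential factor. The last
  factor is the share of the integral of u * exp(-E u) inside the window. The bound on K / E keeps
  the relative displacement in 1 - s below 1/2.\<close>

lemma beta_excess_ge:
  fixes x :: real
  assumes x: "0 < x" "x < 1" and E: "E = real l / (1 - x) - real q / x" "E > 0"
    and K: "K \<ge> 0" "K / E \<le> (1 - x) / 2"
  shows "x ^ q * (1 - x) ^ l / E\<^sup>2 * (exp (- ((real q / x\<^sup>2 + 2 * real l / (1 - x)\<^sup>2) * (K / E)\<^sup>2)) * (1 - (1 + K) * exp (- K)))
    \<le> integral {x..1} (\<lambda>s. (s - x) * (s ^ q * (1 - s) ^ l))"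
proof -
  define w where "w = x ^ q * (1 - x) ^ l"
  define T where "T = K / E"
  define \<delta> where "\<delta> = real q / x\<^sup>2 + 2 * real l / (1 - x)\<^sup>2"
  have w: "w \<ge> 0" using x by (simp add: w_def)
  have \<delta>: "\<delta> \<ge> 0" by (simp add: \<delta>_def)
  have T: "0 \<le> T" "T \<le> (1 - x) / 2" "E * T = K" using K E(2) by (auto simp: T_def)
  have T1: "x + T \<le> 1" using T(2) x by (simp add: field_simps)
  have I: "((\<lambda>s. (s - x) * exp (- E * (s - x))) has_integral (1 - (1 + K) * exp (- K)) / E\<^sup>2) {x..x + T}"
    using integral_linear_exp[OF \<open>E > 0\<close>, of T x] T by simp
  have "w * exp (- (\<delta> * T\<^sup>2)) * ((1 - (1 + K) * exp (- K)) / E\<^sup>2)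
     = integral {x..x + T} (\<lambda>s. w * exp (- (\<delta> * T\<^sup>2)) * ((s - x) * exp (- E * (s - x))))"
    using I by (simp add: integral_unique)
  also have "\<dots> \<le> integral {x..x + T} (\<lambda>s. (s - x) * (s ^ q * (1 - s) ^ l))"
  proof (rule integral_le)
    fix s assume s: "s \<in> {x..x + T}"
    define a where "a = (s - x) / x"
    define b where "b = (s - x) / (1 - x)"
    have ab: "a \<ge> 0" "b \<ge> 0" "b \<le> 1 / 2" using s x T by (auto simp: a_def b_def field_simps)
    have "real q * a\<^sup>2 + 2 * real l * b\<^sup>2 = \<delta> * (s - x)\<^sup>2"
      by (simp add: a_def b_def \<delta>_def power_divide distrib_right)
    also have "\<dots> \<le> \<delta> * T\<^sup>2"
      using s \<delta> by (intro mult_left_mono power_mono) auto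
    finally have d: "real q * a\<^sup>2 + 2 * real l * b\<^sup>2 \<le> \<delta> * T\<^sup>2" .
    have "real q * a - real l * b = - E * (s - x)"
      by (simp add: a_def b_def E(1) algebra_simps)
    then have "- (\<delta> * T\<^sup>2) + - E * (s - x) \<le> real q * (a - a\<^sup>2) + - (real l * (b + 2 * b\<^sup>2))"
      using d by (simp add: algebra_simps)
    then have "exp (- (\<delta> * T\<^sup>2)) * exp (- E * (s - x)) \<le> exp (real q * (a - a\<^sup>2)) * exp (- (real l * (b + 2 * b\<^sup>2)))"
      unfolding exp_add[symmetric] by simp
    also have "\<dots> \<le> (1 + a) ^ q * (1 - b) ^ l"
      using ab by (intro mult_mono one_plus_power_bounds one_minus_power_bounds zero_le_power) auto
    finally have "w * (exp (- (\<delta> * T\<^sup>2)) * exp (- E * (s - x))) \<le> s ^ q * (1 - s) ^ l"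
      unfolding beta_weight_factor[OF x, of s] w_def[symmetric] a_def[symmetric] b_def[symmetric]
      using w by (intro mult_left_mono)
    then have "(s - x) * (w * (exp (- (\<delta> * T\<^sup>2)) * exp (- E * (s - x)))) \<le> (s - x) * (s ^ q * (1 - s) ^ l)"
      using s by (intro mult_left_mono) auto
    then show "w * exp (- (\<delta> * T\<^sup>2)) * ((s - x) * exp (- E * (s - x))) \<le> (s - x) * (s ^ q * (1 - s) ^ l)"
      by (simp add: mult_ac)
  qed (intro integrable_continuous_interval continuous_intros)+
  also have "\<dots> \<le> integral {x..1} (\<lambda>s. (s - x) * (s ^ q * (1 - s) ^ l))"
    using T1 x by (intro integral_subset_le integrable_continuous_interval continuous_intros) auto
  finally show ?thesis
    by (simp add: w_def T_def \<delta>_def mult_ac)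
qed

section \<open>The asymptotic regime\<close>

lemma gumbel_centring_at_top:
  "filterlim (\<lambda>L::real. sqrt L - ln (sqrt (2 * pi) * L) / sqrt L + t / sqrt L) at_top at_top"
  by real_asymp

lemma gumbel_centring_ratio:
  "((\<lambda>L::real. (sqrt L - ln (sqrt (2 * pi) * L) / sqrt L + t / sqrt L) / sqrt L) \<longlongrightarrow> 1) at_top"
  by real_asymp

text \<open>Writing v for the bracket, v^2 = L - 2 ln(sqrt(2 pi) L) + 2t + o(1), so the exponential
  is asymptotic to sqrt(2 pi) * L * exp(-t), while v^2 is asymptotic to L.\<close>

lemma gumbel_centring_tail:
  "((\<lambda>L::real. exp (L / 2 - (sqrt L - ln (sqrt (2 * pi) * L) / sqrt L + t / sqrt L)\<^sup>2 / 2)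
      / (sqrt L - ln (sqrt (2 * pi) * L) / sqrt L + t / sqrt L)\<^sup>2) \<longlongrightarrow> sqrt (2 * pi) * exp (- t)) at_top"
proof -
  have "exp (- ((t * 2 - ln (root 2 (2 * pi)) * 2) / 2)) = sqrt (2 * pi) * exp (- t)"
    unfolding sqrt_def[symmetric] by (simp add: diff_divide_distrib exp_diff exp_minus field_simps)
  moreover have "((\<lambda>L::real. exp (L / 2 - (sqrt L - ln (sqrt (2 * pi) * L) / sqrt L + t / sqrt L)\<^sup>2 / 2)
      / (sqrt L - ln (sqrt (2 * pi) * L) / sqrt L + t / sqrt L)\<^sup>2)
      \<longlongrightarrow> exp (- ((t * 2 - ln (root 2 (2 * pi)) * 2) / 2))) at_top"
    by real_asymp
  ultimately show ?thesis by (simp only:)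
qed

text \<open>Each inequality holds because a difference vanishing at 0 has a nonnegative derivative.
  The quadratic coefficient must be exact here, since the quadratic terms form the Gaussian
  exponent; only the cubic remainder may be crude.\<close>

lemma ln_one_plus_cubic:
  assumes "0 \<le> (a::real)" "a \<le> 1"
  shows "\<bar>ln (1 + a) - (a - a\<^sup>2 / 2)\<bar> \<le> a ^ 3"
proof -
  define f where "f u = ln (1 + u) - (u - u\<^sup>2 / 2)" for u :: real
  define g where "g u = u - u\<^sup>2 / 2 + u ^ 3 - ln (1 + u)" for u :: real
  have "f 0 \<le> f a"
  proof (rule DERIV_nonneg_imp_nondecreasing[OF assms(1)])
    fix u :: real assume u: "0 \<le> u" "u \<le> a"
    have "(f has_real_derivative u\<^sup>2 / (1 + u)) (at u)"
      unfolding f_def using u by (auto intro!: derivative_eq_intros simp: field_simps power2_eq_square)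
    then show "\<exists>y. (f has_real_derivative y) (at u) \<and> 0 \<le> y" using u by (intro exI[of _ "u\<^sup>2 / (1 + u)"]) auto
  qed
  moreover have "g 0 \<le> g a"
  proof (rule DERIV_nonneg_imp_nondecreasing[OF assms(1)])
    fix u :: real assume u: "0 \<le> u" "u \<le> a"
    have "(g has_real_derivative u\<^sup>2 * (2 + 3 * u) / (1 + u)) (at u)"
      unfolding g_def using u by (auto intro!: derivative_eq_intros simp: field_simps power2_eq_square power3_eq_cube)
    then show "\<exists>y. (g has_real_derivative y) (at u) \<and> 0 \<le> y" using u by (intro exI[of _ "u\<^sup>2 * (2 + 3 * u) / (1 + u)"]) auto
  qed
  ultimately show ?thesis by (simp add: f_def g_def abs_le_iff)
qed

lemma ln_one_minus_cubic:
  assumes "0 \<le> (b::real)" "b \<le> 1 / 2"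
  shows "\<bar>ln (1 - b) + (b + b\<^sup>2 / 2)\<bar> \<le> b ^ 3"
proof -
  define f where "f u = - ln (1 - u) - (u + u\<^sup>2 / 2)" for u :: real
  define g where "g u = u + u\<^sup>2 / 2 + u ^ 3 + ln (1 - u)" for u :: real
  have "f 0 \<le> f b"
  proof (rule DERIV_nonneg_imp_nondecreasing[OF assms(1)])
    fix u :: real assume u: "0 \<le> u" "u \<le> b"
    then have "u < 1" using assms by linarith
    then have "(f has_real_derivative u\<^sup>2 / (1 - u)) (at u)"
      unfolding f_def using u by (auto intro!: derivative_eq_intros simp: field_simps power2_eq_square)
    then show "\<exists>y. (f has_real_derivative y) (at u) \<and> 0 \<le> y" using \<open>u < 1\<close> by (intro exI[of _ "u\<^sup>2 / (1 - u)"]) auto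
  qed
  moreover have "g 0 \<le> g b"
  proof (rule DERIV_nonneg_imp_nondecreasing[OF assms(1)])
    fix u :: real assume u: "0 \<le> u" "u \<le> b"
    \<comment> \<open>The bound 1/2 on b keeps the numerator 2 - 3u nonnegative.\<close>
    then have "u < 1" "0 \<le> 2 - 3 * u" using assms by linarith+
    then have "(g has_real_derivative u\<^sup>2 * (2 - 3 * u) / (1 - u)) (at u)"
      unfolding g_def using u by (auto intro!: derivative_eq_intros simp: field_simps power2_eq_square power3_eq_cube)
    then show "\<exists>y. (g has_real_derivative y) (at u) \<and> 0 \<le> y"
      using \<open>u < 1\<close> \<open>0 \<le> 2 - 3 * u\<close> by (intro exI[of _ "u\<^sup>2 * (2 - 3 * u) / (1 - u)"]) auto
  qed
  ultimately show ?thesis by (simp add: f_def g_def abs_le_iff)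
qed

text \<open>To be read with P = p - 1 and m = n - p, so that N = n - 1, c^2 = P / N and y = n c^2 /
  (1 - c^2). The assumptions are all that the asymptotic analysis uses of the two growth conditions,
  so both are treated by one argument.\<close>

locale beta_regime =
  fixes P m :: "nat \<Rightarrow> nat" and N y L :: "nat \<Rightarrow> real"
  defines "N \<equiv> \<lambda>n. real (P n) + real (m n)"
    and "y \<equiv> \<lambda>n. (N n + 1) * real (P n) / real (m n)"
    and "L \<equiv> \<lambda>n. ln (y n)"
  assumes P_top: "filterlim P at_top sequentially"
    and m_top: "filterlim m at_top sequentially"
    and L_top: "filterlim L at_top sequentially"
    and L3_P: "(\<lambda>n. L n ^ 3 / real (P n)) \<longlonglongrightarrow> 0"
    and L3_m: "(\<lambda>n. L n ^ 3 / real (m n)) \<longlonglongrightarrow> 0"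
begin

text \<open>The weight \<open>s\<^sup>P (1 - s)\<^sup>m\<close> has its mode at \<open>P / N\<close> and standard deviation about \<open>rho / N\<close>;
  \<open>kap\<close> and \<open>lam\<close> are this deviation relative to \<open>P / N\<close> and to \<open>m / N\<close>. With \<open>vv t n = a y + b y * t\<close>,
  the threshold \<open>xx t n = (A + B t)\<^sup>2\<close> lies \<open>dd t n\<close> deviations above the mode, and \<open>ee\<close> is the
  exponential decay rate of \<open>s\<^sup>P (1 - s)\<^sup>m\<^sup>-\<^sup>1\<close> there.\<close>

definition kap where "kap n = sqrt (real (m n) / (real (P n) * N n))"
definition lam where "lam n = sqrt (real (P n) / (real (m n) * N n))"
definition rho where "rho n = sqrt (real (P n) * real (m n) / N n)"
definition vv where "vv t n = sqrt (L n) - ln (sqrt (2 * pi) * L n) / sqrt (L n) + t / sqrt (L n)"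
definition dd where "dd t n = vv t n + (vv t n)\<^sup>2 * kap n / 4"
definition xx where "xx t n = real (P n) / N n * (1 + dd t n * kap n)"
definition ee where "ee t n = real (m n - 1) / (1 - xx t n) - real (P n) / xx t n"

lemma ev_pos: "\<forall>\<^sub>F n in sequentially. P n > 0 \<and> m n > 1 \<and> L n > 1"
proof -
  have "\<forall>\<^sub>F n in sequentially. P n > 0" "\<forall>\<^sub>F n in sequentially. m n > 1" "\<forall>\<^sub>F n in sequentially. L n > 1"
    by (rule eventually_compose_filterlim[OF eventually_gt_at_top], fact P_top m_top L_top)+
  then show ?thesis by eventually_elim simp
qed

lemma scale_identities:
  assumes "P n > 0" "m n > 0"
  shows "N n > 0" "kap n > 0" "lam n > 0" "rho n > 0"
    "real (P n) * kap n = rho n" "real (m n) * lam n = rho n" "rho n * kap n = real (m n) / N n" "rho n * lam n = real (P n) / N n"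
    "(rho n)\<^sup>2 = real (P n) * real (m n) / N n" "(kap n)\<^sup>2 = real (m n) / (real (P n) * N n)" "(lam n)\<^sup>2 = real (P n) / (real (m n) * N n)"
proof -
  show N: "N n > 0" using assms by (simp add: N_def)
  show k: "kap n > 0" "lam n > 0" "rho n > 0" using assms N by (simp_all add: kap_def lam_def rho_def)
  show sq: "(rho n)\<^sup>2 = real (P n) * real (m n) / N n" "(kap n)\<^sup>2 = real (m n) / (real (P n) * N n)" "(lam n)\<^sup>2 = real (P n) / (real (m n) * N n)"
    using assms N by (simp_all add: kap_def lam_def rho_def)
  have "(real (P n) * kap n)\<^sup>2 = (rho n)\<^sup>2" "(real (m n) * lam n)\<^sup>2 = (rho n)\<^sup>2"
    unfolding power_mult_distrib sq using assms N by (simp_all add: field_simps power2_eq_square)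
  then show pk: "real (P n) * kap n = rho n" and ml: "real (m n) * lam n = rho n"
    using k by (auto intro: power2_eq_imp_eq)
  have "rho n * kap n = real (P n) * (kap n)\<^sup>2"
    by (simp add: pk[symmetric] power2_eq_square)
  moreover have "rho n * lam n = real (m n) * (lam n)\<^sup>2"
    by (simp add: ml[symmetric] power2_eq_square)
  ultimately show "rho n * kap n = real (m n) / N n" "rho n * lam n = real (P n) / N n"
    unfolding sq using assms N by (simp_all add: field_simps)
qed

lemma vv_top: "filterlim (vv t) at_top sequentially"
  using filterlim_compose[OF gumbel_centring_at_top L_top] by (simp add: vv_def[abs_def])

lemma vv_ratio: "(\<lambda>n. vv t n / sqrt (L n)) \<longlonglongrightarrow> 1"
  using filterlim_compose[OF gumbel_centring_ratio L_top] by (simp add: vv_def[abs_def])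

lemma vv_tail: "(\<lambda>n. exp (L n / 2 - (vv t n)\<^sup>2 / 2) / (vv t n)\<^sup>2) \<longlonglongrightarrow> sqrt (2 * pi) * exp (- t)"
  using filterlim_compose[OF gumbel_centring_tail L_top] by (simp add: vv_def[abs_def])

text \<open>v is asymptotic to sqrt L, and \<open>kap\<close>^2 \<le> 1/P, \<open>lam\<close>^2
  \<le> 1/m, so the products are of order at most sqrt(L^3 / P) and sqrt(L^3 / m).\<close>

lemma vv_cubed_scale:
  "(\<lambda>n. vv t n ^ 3 * kap n) \<longlonglongrightarrow> 0" "(\<lambda>n. vv t n ^ 3 * lam n) \<longlonglongrightarrow> 0"
proof -
  have aux: "(\<lambda>n. vv t n ^ 3 * k n) \<longlonglongrightarrow> 0"
    if lim: "(\<lambda>n. L n ^ 3 / real (Q n)) \<longlonglongrightarrow> 0"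
      and k: "\<forall>\<^sub>F n in sequentially. Q n > 0 \<and> 0 \<le> k n \<and> (k n)\<^sup>2 \<le> 1 / real (Q n)" for k Q
  proof -
    have "(\<lambda>n. sqrt (L n ^ 3 / real (Q n))) \<longlonglongrightarrow> sqrt 0"
      by (intro tendsto_real_sqrt lim)
    then have s: "(\<lambda>n. sqrt (L n ^ 3 / real (Q n))) \<longlonglongrightarrow> 0" by simp
    have "(\<lambda>n. sqrt (L n) ^ 3 * k n) \<longlonglongrightarrow> 0"
    proof (rule tendsto_sandwich[OF _ _ tendsto_const s])
      show "\<forall>\<^sub>F n in sequentially. 0 \<le> sqrt (L n) ^ 3 * k n"
        using k ev_pos by eventually_elim simp
      show "\<forall>\<^sub>F n in sequentially. sqrt (L n) ^ 3 * k n \<le> sqrt (L n ^ 3 / real (Q n))"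
        using k ev_pos
      proof eventually_elim
        case (elim n)
        have "(sqrt (L n) ^ 3)\<^sup>2 = (sqrt (L n) ^ 2) ^ 3"
          by (simp flip: power_mult)
        then have "(sqrt (L n) ^ 3 * k n)\<^sup>2 = L n ^ 3 * (k n)\<^sup>2"
          using elim by (simp add: power_mult_distrib)
        also have "\<dots> \<le> L n ^ 3 * (1 / real (Q n))"
          using elim by (intro mult_left_mono) auto
        finally show ?case by (intro real_le_rsqrt) simp
      qed
    qed
    then have "(\<lambda>n. (vv t n / sqrt (L n)) ^ 3 * (sqrt (L n) ^ 3 * k n)) \<longlonglongrightarrow> 1 ^ 3 * 0"
      by (intro tendsto_mult tendsto_power vv_ratio)
    then have "(\<lambda>n. (vv t n / sqrt (L n)) ^ 3 * (sqrt (L n) ^ 3 * k n)) \<longlonglongrightarrow> 0" by simp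
    then show ?thesis
    proof (rule Lim_transform_eventually)
      show "\<forall>\<^sub>F n in sequentially. (vv t n / sqrt (L n)) ^ 3 * (sqrt (L n) ^ 3 * k n) = vv t n ^ 3 * k n"
        using ev_pos by eventually_elim (simp add: power_divide)
    qed
  qed
  show "(\<lambda>n. vv t n ^ 3 * kap n) \<longlonglongrightarrow> 0"
    using ev_pos by (intro aux[OF L3_P], eventually_elim)
      (auto simp: scale_identities less_imp_le field_simps, simp add: N_def)
  show "(\<lambda>n. vv t n ^ 3 * lam n) \<longlonglongrightarrow> 0"
    using ev_pos by (intro aux[OF L3_m], eventually_elim)
      (auto simp: scale_identities less_imp_le field_simps, simp add: N_def)
qed

lemma vv_ge_1: "\<forall>\<^sub>F n in sequentially. vv t n \<ge> 1"
  using vv_top by (simp add: filterlim_at_top)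

lemma inverse_vv: "(\<lambda>n. 1 / vv t n) \<longlonglongrightarrow> 0"
  using tendsto_inverse_0_at_top[OF vv_top] by (simp add: inverse_eq_divide)

lemma vv_kap: "(\<lambda>n. vv t n * kap n) \<longlonglongrightarrow> 0"
proof -
  have "(\<lambda>n. vv t n ^ 3 * kap n * (1 / vv t n)\<^sup>2) \<longlonglongrightarrow> 0 * 0\<^sup>2"
    by (intro tendsto_mult tendsto_power vv_cubed_scale inverse_vv)
  then have "(\<lambda>n. vv t n ^ 3 * kap n * (1 / vv t n)\<^sup>2) \<longlonglongrightarrow> 0" by simp
  then show ?thesis
    by (rule Lim_transform_eventually)
      (use vv_ge_1[of t] in \<open>eventually_elim, simp add: power2_eq_square power3_eq_cube\<close>)
qed

lemma dd_ratio: "(\<lambda>n. dd t n / vv t n) \<longlonglongrightarrow> 1"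
proof -
  have "(\<lambda>n. 1 + vv t n * kap n / 4) \<longlonglongrightarrow> 1 + 0 / 4"
    by (intro tendsto_intros vv_kap) auto
  then have "(\<lambda>n. 1 + vv t n * kap n / 4) \<longlonglongrightarrow> 1" by simp
  then show ?thesis
    by (rule Lim_transform_eventually)
      (use vv_ge_1[of t] in \<open>eventually_elim, simp add: dd_def power2_eq_square field_simps\<close>)
qed

lemma vv_dd_ratio: "(\<lambda>n. vv t n / dd t n) \<longlonglongrightarrow> 1"
  using tendsto_inverse[OF dd_ratio[of t]] by (simp add: inverse_eq_divide)

lemma dd_ge_vv: "\<forall>\<^sub>F n in sequentially. dd t n \<ge> vv t n"
  using ev_pos by eventually_elim (simp add: dd_def scale_identities less_imp_le)

lemma dd_top: "filterlim (dd t) at_top sequentially"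
  using filterlim_at_top_mono[OF vv_top dd_ge_vv] .

lemma dd_scale:
  "(\<lambda>n. dd t n ^ 3 * kap n) \<longlonglongrightarrow> 0" "(\<lambda>n. dd t n ^ 3 * lam n) \<longlonglongrightarrow> 0"
  "(\<lambda>n. dd t n * kap n) \<longlonglongrightarrow> 0" "(\<lambda>n. dd t n * lam n) \<longlonglongrightarrow> 0"
proof -
  have aux: "(\<lambda>n. dd t n ^ 3 * k n) \<longlonglongrightarrow> 0" "(\<lambda>n. dd t n * k n) \<longlonglongrightarrow> 0"
    if "(\<lambda>n. vv t n ^ 3 * k n) \<longlonglongrightarrow> 0" for k
  proof -
    have "(\<lambda>n. (dd t n / vv t n) ^ 3 * (vv t n ^ 3 * k n)) \<longlonglongrightarrow> 1 ^ 3 * 0"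
      by (intro tendsto_mult tendsto_power dd_ratio that)
    then have *: "(\<lambda>n. (dd t n / vv t n) ^ 3 * (vv t n ^ 3 * k n)) \<longlonglongrightarrow> 0" by simp
    show d3: "(\<lambda>n. dd t n ^ 3 * k n) \<longlonglongrightarrow> 0"
      by (rule Lim_transform_eventually[OF *])
        (use vv_ge_1[of t] in \<open>eventually_elim, simp add: power_divide\<close>)
    have "(\<lambda>n. dd t n ^ 3 * k n * (vv t n / dd t n * (1 / vv t n))\<^sup>2) \<longlonglongrightarrow> 0 * (1 * 0)\<^sup>2"
      by (intro tendsto_mult tendsto_power vv_dd_ratio d3 inverse_vv)
    then have *: "(\<lambda>n. dd t n ^ 3 * k n * (vv t n / dd t n * (1 / vv t n))\<^sup>2) \<longlonglongrightarrow> 0" by simp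
    show "(\<lambda>n. dd t n * k n) \<longlonglongrightarrow> 0"
    proof (rule Lim_transform_eventually[OF *])
      show "\<forall>\<^sub>F n in sequentially. dd t n ^ 3 * k n * (vv t n / dd t n * (1 / vv t n))\<^sup>2 = dd t n * k n"
        using vv_ge_1[of t] dd_ge_vv[of t]
      proof eventually_elim
        case (elim n)
        then have "dd t n > 0" "vv t n > 0" by linarith+
        then show ?case by (simp add: power2_eq_square power3_eq_cube)
      qed
    qed
  qed
  show "(\<lambda>n. dd t n ^ 3 * kap n) \<longlonglongrightarrow> 0" "(\<lambda>n. dd t n ^ 3 * lam n) \<longlonglongrightarrow> 0"
    "(\<lambda>n. dd t n * kap n) \<longlonglongrightarrow> 0" "(\<lambda>n. dd t n * lam n) \<longlonglongrightarrow> 0"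
    by (intro aux vv_cubed_scale)+
qed

text \<open>The inverse square of \<open>rho\<close> is 1/m + 1/P.\<close>

lemma rho_top: "filterlim rho at_top sequentially"
proof -
  have P': "filterlim (\<lambda>n. real (P n)) at_top sequentially" and m': "filterlim (\<lambda>n. real (m n)) at_top sequentially"
    by (intro filterlim_compose[OF filterlim_real_sequentially] P_top m_top)+
  have "(\<lambda>n. sqrt (inverse (real (m n)) + inverse (real (P n)))) \<longlonglongrightarrow> sqrt (0 + 0)"
    by (intro tendsto_real_sqrt tendsto_add tendsto_inverse_0_at_top P' m')
  then have "(\<lambda>n. sqrt (inverse (real (m n)) + inverse (real (P n)))) \<longlonglongrightarrow> 0" by simp
  moreover have "\<forall>\<^sub>F n in sequentially. sqrt (inverse (real (m n)) + inverse (real (P n))) = inverse (rho n)"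
    using ev_pos
  proof eventually_elim
    case (elim n)
    then have "inverse (real (m n)) + inverse (real (P n)) = inverse (real (P n) * real (m n) / N n)"
      by (simp add: N_def field_simps)
    then show ?case by (simp only: rho_def real_sqrt_inverse)
  qed
  ultimately have "(\<lambda>n. inverse (rho n)) \<longlonglongrightarrow> 0"
    by (rule Lim_transform_eventually)
  moreover have "\<forall>\<^sub>F n in sequentially. inverse (rho n) > 0"
    using ev_pos by eventually_elim (simp add: scale_identities)
  ultimately have "filterlim (\<lambda>n. inverse (inverse (rho n))) at_top sequentially"
    by (rule filterlim_inverse_at_top)
  then show ?thesis by simp
qed

lemma one_minus_xx:
  assumes "P n > 0" "m n > 0"
  shows "1 - xx t n = real (m n) / N n * (1 - dd t n * lam n)"
proof -
  note s = scale_identities[OF assms]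
  have k: "real (P n) / N n * kap n = real (m n) / N n * lam n"
    by (simp add: s(5,6))
  have p: "1 - real (P n) / N n = real (m n) / N n"
    using s(1) by (simp add: N_def field_simps)
  have "1 - xx t n = (1 - real (P n) / N n) - dd t n * (real (P n) / N n * kap n)"
    by (simp add: xx_def distrib_left)
  then show ?thesis
    unfolding k p by (simp add: right_diff_distrib)
qed

text \<open>Gathers the side conditions that hold for large n. The last one ensures that the Laplace
  window with K = sqrt v fits into the left half of [x, 1].\<close>

lemma ev_range:
  "\<forall>\<^sub>F n in sequentially. P n > 0 \<and> m n > 1 \<and> 1 \<le> vv t n \<and> vv t n \<le> dd t n \<and> 0 < dd t n
     \<and> 0 \<le> dd t n * kap n \<and> dd t n * kap n \<le> 1 / 2 \<and> 0 \<le> dd t n * lam n \<and> dd t n * lam n \<le> 1 / 2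
     \<and> 0 < xx t n \<and> xx t n < 1 \<and> 1 - xx t n \<le> real (m n) / N n \<and> 2 * sqrt (vv t n) + 1 \<le> rho n * dd t n"
proof -
  have k: "\<forall>\<^sub>F n in sequentially. dd t n * kap n < 1 / 2" "\<forall>\<^sub>F n in sequentially. dd t n * lam n < 1 / 2"
    by (rule order_tendstoD[OF dd_scale(3)] order_tendstoD[OF dd_scale(4)], simp)+
  have r: "\<forall>\<^sub>F n in sequentially. rho n \<ge> 3"
    using rho_top by (simp add: filterlim_at_top)
  show ?thesis
    using ev_pos vv_ge_1[of t] dd_ge_vv[of t] k r
  proof eventually_elim
    case (elim n)
    then have pm: "P n > 0" "m n > 0" by auto
    note s = scale_identities[OF pm]
    have d: "0 < dd t n" using elim by linarith
    then have al: "0 \<le> dd t n * kap n" "0 \<le> dd t n * lam n" using s by simp_all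
    have "0 < xx t n" using s pm al by (simp add: xx_def add_pos_nonneg)
    moreover have "0 < 1 - xx t n"
      unfolding one_minus_xx[OF pm] using s(1) pm elim by simp
    moreover have "1 - xx t n \<le> real (m n) / N n"
      unfolding one_minus_xx[OF pm] using s(1) pm al by (intro mult_left_le) auto
    moreover have "2 * sqrt (vv t n) + 1 \<le> rho n * dd t n"
    proof -
      have "sqrt (vv t n) \<le> vv t n"
        using elim by (intro real_le_lsqrt) (auto simp: power2_eq_square)
      then have "2 * sqrt (vv t n) + 1 \<le> 3 * vv t n" using elim by linarith
      also have "\<dots> \<le> rho n * dd t n"
        using elim by (intro mult_mono) auto
      finally show ?thesis .
    qed
    ultimately show ?case using elim d al by simp
  qed
qed

lemma xx_rho_dd: "(\<lambda>n. xx t n / (rho n * dd t n)) \<longlonglongrightarrow> 0"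
proof -
  have "filterlim (\<lambda>n. rho n * dd t n) at_top sequentially"
    by (intro filterlim_at_top_mult_at_top rho_top dd_top)
  from tendsto_inverse_0_at_top[OF this] have u: "(\<lambda>n. 1 / (rho n * dd t n)) \<longlonglongrightarrow> 0"
    by (simp add: inverse_eq_divide)
  show ?thesis
  proof (rule tendsto_sandwich[OF _ _ tendsto_const u])
    show "\<forall>\<^sub>F n in sequentially. 0 \<le> xx t n / (rho n * dd t n)"
      using ev_range[of t] by eventually_elim (simp add: scale_identities less_imp_le)
    show "\<forall>\<^sub>F n in sequentially. xx t n / (rho n * dd t n) \<le> 1 / (rho n * dd t n)"
      using ev_range[of t] by eventually_elim (simp add: scale_identities less_imp_le divide_right_mono)
  qed
qed

text \<open>Since N x - P = \<open>rho\<close> * d, the numerator would be exactly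
  \<open>rho\<close> * d for the exponents P and m; the correction -x stems from the exponent m -
  1.\<close>

lemma ee_eq:
  assumes "P n > 0" "m n > 0" "0 < xx t n" "xx t n < 1"
  shows "ee t n = (rho n * dd t n - xx t n) / (xx t n * (1 - xx t n))"
proof -
  note s = scale_identities[OF assms(1,2)]
  have "real (m n - 1) = real (m n) - 1" using assms by simp
  then have "ee t n = ((real (m n) - 1) * xx t n - real (P n) * (1 - xx t n)) / (xx t n * (1 - xx t n))"
    using assms(3,4) by (simp add: ee_def field_simps)
  moreover have "N n * xx t n = real (P n) + rho n * dd t n"
    using s(1) by (simp add: xx_def algebra_simps flip: s(5))
  then have "(real (m n) - 1) * xx t n - real (P n) * (1 - xx t n) = rho n * dd t n - xx t n"
    by (simp add: N_def algebra_simps)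
  ultimately show ?thesis by simp
qed

text \<open>The Taylor remainders are of order \<open>P (d kap)\<^sup>3 \<le> d\<^sup>3 kap\<close> and \<open>m (d lam)\<^sup>3 \<le> d\<^sup>3 lam\<close>;
  this is where the cube of the logarithm in the growth condition is needed.\<close>

lemma log_weight_asymp:
  "(\<lambda>n. real (P n) * ln (1 + dd t n * kap n) + real (m n) * ln (1 - dd t n * lam n) + (vv t n)\<^sup>2 / 2) \<longlonglongrightarrow> 0"
proof -
  \<comment> \<open>The expansion produces d^2/2 while the centring is tuned to v^2/2; their
    difference is of order v^3 * \<open>kap\<close>.\<close>
  have q: "(\<lambda>n. ((vv t n)\<^sup>2 - (dd t n)\<^sup>2) / 2) \<longlonglongrightarrow> 0"
  proof -
    have "(\<lambda>n. - (vv t n ^ 3 * kap n / 4 + vv t n ^ 3 * kap n * (vv t n * kap n) / 32)) \<longlonglongrightarrow> - (0 / 4 + 0 * 0 / 32)"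
      by (intro tendsto_intros vv_kap vv_cubed_scale) auto
    moreover have "((vv t n)\<^sup>2 - (dd t n)\<^sup>2) / 2 = - (vv t n ^ 3 * kap n / 4 + vv t n ^ 3 * kap n * (vv t n * kap n) / 32)" for n
      by (simp add: dd_def power2_eq_square power3_eq_cube field_simps)
    moreover have "- (0 / 4 + 0 * 0 / 32) = (0 :: real)" by simp
    ultimately show ?thesis by (simp only:)
  qed
  have r: "(\<lambda>n. real (P n) * ln (1 + dd t n * kap n) + real (m n) * ln (1 - dd t n * lam n) + (dd t n)\<^sup>2 / 2) \<longlonglongrightarrow> 0"
  proof (rule tendsto_rabs_zero_cancel, rule tendsto_sandwich[OF _ _ tendsto_const])
    show "(\<lambda>n. dd t n ^ 3 * kap n + dd t n ^ 3 * lam n) \<longlonglongrightarrow> 0"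
      using tendsto_add[OF dd_scale(1,2)] by simp
    show "\<forall>\<^sub>F n in sequentially. 0 \<le> \<bar>real (P n) * ln (1 + dd t n * kap n) + real (m n) * ln (1 - dd t n * lam n) + (dd t n)\<^sup>2 / 2\<bar>"
      by simp
    show "\<forall>\<^sub>F n in sequentially. \<bar>real (P n) * ln (1 + dd t n * kap n) + real (m n) * ln (1 - dd t n * lam n) + (dd t n)\<^sup>2 / 2\<bar>
        \<le> dd t n ^ 3 * kap n + dd t n ^ 3 * lam n"
      using ev_range[of t]
    proof eventually_elim
      case (elim n)
      then have pm: "P n > 0" "m n > 0" by auto
      note s = scale_identities[OF pm]
      define a where "a = dd t n * kap n"
      define b where "b = dd t n * lam n"
      have a: "\<bar>ln (1 + a) - (a - a\<^sup>2 / 2)\<bar> \<le> a ^ 3"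
        unfolding a_def using elim by (intro ln_one_plus_cubic) auto
      have b: "\<bar>ln (1 - b) + (b + b\<^sup>2 / 2)\<bar> \<le> b ^ 3"
        unfolding b_def using elim by (intro ln_one_minus_cubic) auto
      \<comment> \<open>The linear terms cancel because the expansion is centred at the mode of s^P
        (1-s)^m.\<close>
      have lin: "real (P n) * a = real (m n) * b"
        using s(5,6) by (simp add: a_def b_def algebra_simps)
      have pk: "real (P n) * (kap n)\<^sup>2 = real (m n) / N n" "real (m n) * (lam n)\<^sup>2 = real (P n) / N n"
        unfolding s using pm by simp_all
      have "real (P n) * a\<^sup>2 + real (m n) * b\<^sup>2 = (dd t n)\<^sup>2 * (real (P n) * (kap n)\<^sup>2 + real (m n) * (lam n)\<^sup>2)"
        by (simp add: a_def b_def power_mult_distrib algebra_simps)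
      also have "\<dots> = (dd t n)\<^sup>2"
        unfolding pk add_divide_distrib[symmetric] using s(1) by (simp add: N_def add.commute)
      finally have "real (P n) * ln (1 + a) + real (m n) * ln (1 - b) + (dd t n)\<^sup>2 / 2
         = real (P n) * (ln (1 + a) - (a - a\<^sup>2 / 2)) + real (m n) * (ln (1 - b) + (b + b\<^sup>2 / 2))"
        using lin by (simp add: algebra_simps)
      also have "\<bar>\<dots>\<bar> \<le> real (P n) * a ^ 3 + real (m n) * b ^ 3"
        using a b by (intro order_trans[OF abs_triangle_ineq] add_mono) (simp_all add: abs_mult mult_left_mono)
      also have "real (P n) * a ^ 3 + real (m n) * b ^ 3
          = dd t n ^ 3 * kap n * (real (P n) * (kap n)\<^sup>2) + dd t n ^ 3 * lam n * (real (m n) * (lam n)\<^sup>2)"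
        by (simp add: a_def b_def power2_eq_square power3_eq_cube)
      also have "\<dots> \<le> dd t n ^ 3 * kap n + dd t n ^ 3 * lam n"
        unfolding pk using elim s(1-3) by (intro add_mono mult_left_le) (auto simp: N_def less_imp_le)
      finally show ?case by (simp only: a_def b_def)
    qed
  qed
  from tendsto_add[OF q r] show ?thesis
    by (simp add: diff_divide_distrib add_ac)
qed


section \<open>Laplace main term and error control\<close>

text \<open>The binomial probability at its mode, times the standard deviation
  \<open>rho\<close>.\<close>

definition bin_weight where
  "bin_weight n = fact (P n + m n) / (fact (P n) * fact (m n)) * (real (P n) / N n) ^ P n * (real (m n) / N n) ^ m n * rho n"

text \<open>The coefficient of the excess integral in \<open>sum_beta_tail\<close> for q = P and l =
  m - 1.\<close>

definition prefactor where
  "prefactor t n = fact (P n + m n + 1) / (fact (P n) * fact (m n - 1)) / (1 - xx t n)"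

definition laplace_main where
  "laplace_main t n = prefactor t n * (xx t n ^ P n * (1 - xx t n) ^ (m n - 1) / (ee t n)\<^sup>2)"

lemma bin_weight_asymp: "bin_weight \<longlonglongrightarrow> 1 / sqrt (2 * pi)"
  using binomial_weight_asymp[OF P_top m_top] by (simp add: bin_weight_def[abs_def] N_def rho_def)

text \<open>The origin of y: these are the powers of P, m, N and \<open>rho\<close> left over from
  the prefactor, the squared decay length and the normalisation of
  \<open>bin_weight\<close>.\<close>

lemma sqrt_y_eq:
  assumes "P n > 0" "m n > 0"
  shows "(N n + 1) * real (m n) * (real (P n) / N n)\<^sup>2 / (rho n * (rho n)\<^sup>2) = sqrt ((N n + 1) / N n) * exp (L n / 2)"
proof -
  note s = scale_identities[OF assms]
  have y: "y n > 0" using assms s(1) by (simp add: y_def)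
  have "(N n + 1) * real (m n) * (real (P n) / N n)\<^sup>2 / (rho n * (rho n)\<^sup>2) = (N n + 1) * (real (P n) / N n) / rho n"
  proof -
    have "real (m n) * (real (P n) / N n)\<^sup>2 = real (P n) / N n * (rho n)\<^sup>2"
      unfolding s(9) by (simp add: power2_eq_square)
    then show ?thesis using s(4) by (simp add: mult.assoc)
  qed
  also have "\<dots> = sqrt ((N n + 1) / N n * y n)"
  proof (rule real_sqrt_unique[symmetric])
    show "((N n + 1) * (real (P n) / N n) / rho n)\<^sup>2 = (N n + 1) / N n * y n"
      unfolding power_divide power_mult_distrib s(9) y_def using assms s(1) by (simp add: field_simps power2_eq_square)
    show "0 \<le> (N n + 1) * (real (P n) / N n) / rho n" using s by simp
  qed
  also have "\<dots> = sqrt ((N n + 1) / N n) * exp (L n / 2)"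
  proof -
    have "exp (L n / 2) = sqrt (y n)"
    proof (rule real_sqrt_unique[symmetric])
      show "(exp (L n / 2))\<^sup>2 = y n"
        using y by (simp add: L_def power2_eq_square exp_add[symmetric])
    qed simp
    then show ?thesis by (simp only: real_sqrt_mult)
  qed
  finally show ?thesis .
qed

text \<open>An exact factorisation in which every factor has its own limit. Quantities that diverge
  separately are paired: exp(L/2) with the Gaussian factor, the factorials with the powers at the
  mode, and the two logarithms with v^2/2.\<close>

lemma laplace_main_eq:
  assumes pm: "P n > 0" "m n > 0" and x: "0 < xx t n" "xx t n < 1" and vd: "vv t n > 0" "dd t n > 0"
    and ab: "dd t n * kap n \<ge> 0" "dd t n * lam n \<le> 1 / 2"
  shows "laplace_main t n = sqrt ((N n + 1) / N n) * bin_weight n * (1 + dd t n * kap n)\<^sup>2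
      * (1 / (1 - xx t n / (rho n * dd t n)))\<^sup>2 * (vv t n / dd t n)\<^sup>2 * (exp (L n / 2 - (vv t n)\<^sup>2 / 2) / (vv t n)\<^sup>2)
      * exp (real (P n) * ln (1 + dd t n * kap n) + real (m n) * ln (1 - dd t n * lam n) + (vv t n)\<^sup>2 / 2)"
proof -
  note s = scale_identities[OF pm]
  define X where "X = xx t n"
  define a where "a = dd t n * kap n"
  define b where "b = dd t n * lam n"
  define F where "F = (fact (P n + m n) / (fact (P n) * fact (m n)) :: real)"
  define u where "u = X / (rho n * dd t n)"
  define H where "H = real (P n) * ln (1 + a) + real (m n) * ln (1 - b) + (vv t n)\<^sup>2 / 2"
  have X: "0 < X" "X < 1" using x by (simp_all add: X_def)
  have pre: "fact (P n + m n + 1) / (fact (P n) * fact (m n - 1)) = (N n + 1) * real (m n) * F"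
  proof -
    have "fact (m n) = real (m n) * fact (m n - 1)"
      using pm by (simp add: fact_reduce)
    moreover have "fact (P n + m n + 1) = (N n + 1) * fact (P n + m n)"
      by (simp add: N_def add.commute)
    ultimately show ?thesis
      using pm by (simp add: F_def)
  qed
  have "(1 - X) ^ m n = (1 - X) * (1 - X) ^ (m n - 1)"
    using pm by (simp add: power_eq_if)
  moreover have "ee t n = (rho n * dd t n - X) / (X * (1 - X))"
    using ee_eq[OF pm x] by (simp add: X_def)
  moreover have "c / w * (p * q / (e / (X' * w))\<^sup>2) = c * p * (w * q) * X'\<^sup>2 / e\<^sup>2" if "w \<noteq> 0" for c w p q e X' :: real
    using that by (simp add: power_divide power_mult_distrib power2_eq_square)
  ultimately have "laplace_main t n = (N n + 1) * real (m n) * F * X ^ P n * (1 - X) ^ m n * X\<^sup>2 / (rho n * dd t n - X)\<^sup>2"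
    unfolding laplace_main_def prefactor_def pre X_def[symmetric] using X by simp
  also have "X ^ P n = (real (P n) / N n) ^ P n * (1 + a) ^ P n"
    unfolding X_def xx_def a_def by (rule power_mult_distrib)
  also have "(1 - X) ^ m n = (real (m n) / N n) ^ m n * (1 - b) ^ m n"
    unfolding X_def one_minus_xx[OF pm] b_def by (rule power_mult_distrib)
  also have "(1 + a) ^ P n = exp (real (P n) * ln (1 + a))"
    using ab(1) by (simp add: exp_of_nat_mult a_def)
  also have "(1 - b) ^ m n = exp (real (m n) * ln (1 - b))"
    using ab(2) by (simp add: exp_of_nat_mult b_def)
  also have "(rho n * dd t n - X)\<^sup>2 = (rho n)\<^sup>2 * (dd t n)\<^sup>2 * (1 - u)\<^sup>2"
  proof -
    have "rho n * dd t n - X = rho n * dd t n * (1 - u)"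
      using s(4) vd by (simp add: u_def right_diff_distrib)
    then show ?thesis by (simp add: power_mult_distrib)
  qed
  also have "X\<^sup>2 = (real (P n) / N n)\<^sup>2 * (1 + a)\<^sup>2"
    unfolding X_def xx_def a_def by (rule power_mult_distrib)
  also have "(N n + 1) * real (m n) * F * ((real (P n) / N n) ^ P n * exp (real (P n) * ln (1 + a))) *
      ((real (m n) / N n) ^ m n * exp (real (m n) * ln (1 - b))) * ((real (P n) / N n)\<^sup>2 * (1 + a)\<^sup>2) / ((rho n)\<^sup>2 * (dd t n)\<^sup>2 * (1 - u)\<^sup>2)
    = ((N n + 1) * real (m n) * (real (P n) / N n)\<^sup>2 / (rho n * (rho n)\<^sup>2)) * bin_weight n * (1 + a)\<^sup>2 * (1 / (1 - u))\<^sup>2 * (1 / dd t n)\<^sup>2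
      * (exp (real (P n) * ln (1 + a)) * exp (real (m n) * ln (1 - b)))"
  proof -
    have "A * M * F' * (p * e1) * (q * e2) * (r * g) / (R * D * U) = (A * M * r / (\<rho> * R)) * (F' * p * q * \<rho>) * g * (1 / U) * (1 / D) * (e1 * e2)"
      if "\<rho> \<noteq> 0" for A M F' p e1 q e2 r g R D U \<rho> :: real
      using that by (simp add: mult_ac)
    then show ?thesis
      unfolding bin_weight_def F_def[symmetric] power_one_over by this (use s(4) in simp)
  qed
  also have "exp (real (P n) * ln (1 + a)) * exp (real (m n) * ln (1 - b)) = exp H * exp (- ((vv t n)\<^sup>2 / 2))"
    unfolding H_def exp_add[symmetric] by simp
  also have "(1 / dd t n)\<^sup>2 = (vv t n / dd t n)\<^sup>2 / (vv t n)\<^sup>2"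
    using vd by (simp add: power_divide)
  finally have "laplace_main t n = sqrt ((N n + 1) / N n) * exp (L n / 2) * bin_weight n * (1 + a)\<^sup>2 * (1 / (1 - u))\<^sup>2
      * ((vv t n / dd t n)\<^sup>2 / (vv t n)\<^sup>2) * (exp H * exp (- ((vv t n)\<^sup>2 / 2)))"
    unfolding sqrt_y_eq[OF pm] .
  moreover have "exp (L n / 2 - (vv t n)\<^sup>2 / 2) = exp (L n / 2) * exp (- ((vv t n)\<^sup>2 / 2))"
    by (simp only: exp_add[symmetric] diff_conv_add_uminus)
  ultimately show ?thesis
    unfolding H_def a_def b_def u_def X_def by (simp add: mult_ac)
qed

lemma laplace_correction: "(\<lambda>n. 1 / (1 - xx t n / (rho n * dd t n))) \<longlonglongrightarrow> 1"
proof -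
  have "(\<lambda>n. 1 / (1 - xx t n / (rho n * dd t n))) \<longlonglongrightarrow> 1 / (1 - 0)"
    by (intro tendsto_intros xx_rho_dd) auto
  then show ?thesis by simp
qed

lemma laplace_main_asymp: "laplace_main t \<longlonglongrightarrow> exp (- t)"
proof -
  have N: "filterlim N at_top sequentially"
    unfolding N_def
    by (rule filterlim_at_top_mono[OF filterlim_compose[OF filterlim_real_sequentially P_top]]) simp
  have "((\<lambda>x::real. sqrt ((x + 1) / x)) \<longlongrightarrow> 1) at_top" by real_asymp
  from filterlim_compose[OF this N] have n1: "(\<lambda>n. sqrt ((N n + 1) / N n)) \<longlonglongrightarrow> 1" .
  have "(\<lambda>n. sqrt ((N n + 1) / N n) * bin_weight n * (1 + dd t n * kap n)\<^sup>2
      * (1 / (1 - xx t n / (rho n * dd t n)))\<^sup>2 * (vv t n / dd t n)\<^sup>2 * (exp (L n / 2 - (vv t n)\<^sup>2 / 2) / (vv t n)\<^sup>2)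
      * exp (real (P n) * ln (1 + dd t n * kap n) + real (m n) * ln (1 - dd t n * lam n) + (vv t n)\<^sup>2 / 2))
    \<longlonglongrightarrow> 1 * (1 / sqrt (2 * pi)) * (1 + 0)\<^sup>2 * 1\<^sup>2 * 1\<^sup>2 * (sqrt (2 * pi) * exp (- t)) * exp 0"
    by (intro tendsto_mult tendsto_power tendsto_add tendsto_const tendsto_exp n1 bin_weight_asymp dd_scale
        laplace_correction vv_dd_ratio vv_tail log_weight_asymp)
  then have "(\<lambda>n. sqrt ((N n + 1) / N n) * bin_weight n * (1 + dd t n * kap n)\<^sup>2
      * (1 / (1 - xx t n / (rho n * dd t n)))\<^sup>2 * (vv t n / dd t n)\<^sup>2 * (exp (L n / 2 - (vv t n)\<^sup>2 / 2) / (vv t n)\<^sup>2)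
      * exp (real (P n) * ln (1 + dd t n * kap n) + real (m n) * ln (1 - dd t n * lam n) + (vv t n)\<^sup>2 / 2))
    \<longlonglongrightarrow> exp (- t)" by simp
  then show ?thesis
  proof (rule Lim_transform_eventually)
    show "\<forall>\<^sub>F n in sequentially. sqrt ((N n + 1) / N n) * bin_weight n * (1 + dd t n * kap n)\<^sup>2
      * (1 / (1 - xx t n / (rho n * dd t n)))\<^sup>2 * (vv t n / dd t n)\<^sup>2 * (exp (L n / 2 - (vv t n)\<^sup>2 / 2) / (vv t n)\<^sup>2)
      * exp (real (P n) * ln (1 + dd t n * kap n) + real (m n) * ln (1 - dd t n * lam n) + (vv t n)\<^sup>2 / 2) = laplace_main t n"
      using ev_range[of t] by eventually_elim (rule laplace_main_eq[symmetric], auto)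
  qed
qed

text \<open>The curvature coefficient divided by E^2 is of order at most 1/v^2, so a window of K
  decay lengths costs about K^2 / v^2. The choice K = sqrt v makes this of order 1/v, while K still
  tends to infinity.\<close>

lemma laplace_error:
  "(\<lambda>n. (real (P n) / (xx t n)\<^sup>2 + 2 * real (m n - 1) / (1 - xx t n)\<^sup>2) * (sqrt (vv t n) / ee t n)\<^sup>2) \<longlonglongrightarrow> 0"
proof (rule tendsto_sandwich[OF _ _ tendsto_const])
  have "(\<lambda>n. 2 * (1 + dd t n * kap n)\<^sup>2 * (vv t n / dd t n)\<^sup>2 * (1 / vv t n) * (1 / (1 - xx t n / (rho n * dd t n)))\<^sup>2)
     \<longlonglongrightarrow> 2 * (1 + 0)\<^sup>2 * 1\<^sup>2 * 0 * 1\<^sup>2"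
    by (intro tendsto_mult tendsto_power tendsto_add tendsto_const dd_scale laplace_correction vv_dd_ratio inverse_vv)
  then show "(\<lambda>n. 2 * (1 + dd t n * kap n)\<^sup>2 * (vv t n / dd t n)\<^sup>2 * (1 / vv t n) * (1 / (1 - xx t n / (rho n * dd t n)))\<^sup>2) \<longlonglongrightarrow> 0"
    by simp
  show "\<forall>\<^sub>F n in sequentially. 0 \<le> (real (P n) / (xx t n)\<^sup>2 + 2 * real (m n - 1) / (1 - xx t n)\<^sup>2) * (sqrt (vv t n) / ee t n)\<^sup>2"
    by simp
  show "\<forall>\<^sub>F n in sequentially. (real (P n) / (xx t n)\<^sup>2 + 2 * real (m n - 1) / (1 - xx t n)\<^sup>2) * (sqrt (vv t n) / ee t n)\<^sup>2
    \<le> 2 * (1 + dd t n * kap n)\<^sup>2 * (vv t n / dd t n)\<^sup>2 * (1 / vv t n) * (1 / (1 - xx t n / (rho n * dd t n)))\<^sup>2"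
    using ev_range[of t]
  proof eventually_elim
    case (elim n)
    then have pm: "P n > 0" "m n > 0" and x: "0 < xx t n" "xx t n < 1" and vd: "vv t n > 0" "dd t n > 0" by auto
    note s = scale_identities[OF pm]
    define X where "X = xx t n"
    define D where "D = rho n * dd t n - X"
    have X: "0 < X" "X < 1" "1 - X \<le> real (m n) / N n" using elim by (simp_all add: X_def)
    have e: "ee t n = D / (X * (1 - X))"
      using ee_eq[OF pm x] by (simp add: X_def D_def)
    have "(sqrt (vv t n) / ee t n)\<^sup>2 = vv t n * (X\<^sup>2 * (1 - X)\<^sup>2) / D\<^sup>2"
      unfolding e using vd by (simp add: power_divide power_mult_distrib)
    moreover have "(p / c + q / w) * (v * (c * w) / e) = v * (p * w + q * c) / e" if "c \<noteq> 0" "w \<noteq> 0" for p c q w v e :: real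
      using that by (simp add: add_frac_eq mult.commute)
    from this[of "X\<^sup>2" "(1 - X)\<^sup>2"]
    have "(real (P n) / X\<^sup>2 + 2 * real (m n - 1) / (1 - X)\<^sup>2) * (vv t n * (X\<^sup>2 * (1 - X)\<^sup>2) / D\<^sup>2)
       = vv t n * (real (P n) * (1 - X)\<^sup>2 + 2 * real (m n - 1) * X\<^sup>2) / D\<^sup>2"
      using X by simp
    ultimately have "(real (P n) / X\<^sup>2 + 2 * real (m n - 1) / (1 - X)\<^sup>2) * (sqrt (vv t n) / ee t n)\<^sup>2
       = vv t n * (real (P n) * (1 - X)\<^sup>2 + 2 * real (m n - 1) * X\<^sup>2) / D\<^sup>2"
      by (simp only:)
    also have "\<dots> \<le> vv t n * (2 * (1 + dd t n * kap n)\<^sup>2 * (rho n)\<^sup>2) / D\<^sup>2"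
    proof (intro divide_right_mono mult_left_mono)
      have "real (P n) * (1 - X)\<^sup>2 \<le> real (P n) * (real (m n) / N n)\<^sup>2"
        using X by (intro mult_left_mono power_mono) auto
      also have "\<dots> = 1 * (real (P n) * (real (m n) / N n)\<^sup>2)" by simp
      also have "\<dots> \<le> (2 * (1 + dd t n * kap n)\<^sup>2) * (real (P n) * (real (m n) / N n)\<^sup>2)"
      proof (intro mult_right_mono)
        have "1 \<le> (1 + dd t n * kap n)\<^sup>2" using elim by (intro one_le_power) simp
        then show "1 \<le> 2 * (1 + dd t n * kap n)\<^sup>2" by linarith
      qed simp
      finally have 1: "real (P n) * (1 - X)\<^sup>2 \<le> (2 * (1 + dd t n * kap n)\<^sup>2) * (real (P n) * (real (m n) / N n)\<^sup>2)" .
      have "2 * real (m n - 1) * X\<^sup>2 \<le> 2 * real (m n) * X\<^sup>2"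
        by (intro mult_right_mono) auto
      also have "\<dots> = (2 * (1 + dd t n * kap n)\<^sup>2) * (real (m n) * (real (P n) / N n)\<^sup>2)"
      proof -
        have "X\<^sup>2 = (real (P n) / N n)\<^sup>2 * (1 + dd t n * kap n)\<^sup>2"
          unfolding X_def xx_def by (rule power_mult_distrib)
        then show ?thesis by (simp only: mult_ac)
      qed
      finally have "real (P n) * (1 - X)\<^sup>2 + 2 * real (m n - 1) * X\<^sup>2
        \<le> (2 * (1 + dd t n * kap n)\<^sup>2) * (real (P n) * (real (m n) / N n)\<^sup>2 + real (m n) * (real (P n) / N n)\<^sup>2)"
        using 1 by (simp only: distrib_left)
      \<comment> \<open>The two curvature contributions, cleared of denominators, add up to exactly
        \<open>rho\<close>^2, which cancels against the square of \<open>rho\<close> * d in the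
        denominator.\<close>
      also have "real (P n) * (real (m n) / N n)\<^sup>2 + real (m n) * (real (P n) / N n)\<^sup>2 = real (P n) * real (m n) * (real (P n) + real (m n)) / (N n)\<^sup>2"
        by (simp add: power2_eq_square distrib_left add_divide_distrib mult_ac)
      also have "\<dots> = (rho n)\<^sup>2"
      proof -
        have "real (P n) + real (m n) = N n" by (simp add: N_def)
        then show ?thesis unfolding s(9) using s(1) by (simp add: power2_eq_square)
      qed
      finally show "real (P n) * (1 - X)\<^sup>2 + 2 * real (m n - 1) * X\<^sup>2 \<le> 2 * (1 + dd t n * kap n)\<^sup>2 * (rho n)\<^sup>2" .
    qed (use vd in auto)
    also have "\<dots> = 2 * (1 + dd t n * kap n)\<^sup>2 * (vv t n / dd t n)\<^sup>2 * (1 / vv t n) * (1 / (1 - X / (rho n * dd t n)))\<^sup>2"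
    proof -
      have "D = rho n * dd t n * (1 - X / (rho n * dd t n))"
        using s(4) vd by (simp add: D_def right_diff_distrib)
      then have D2: "D\<^sup>2 = (rho n)\<^sup>2 * (dd t n)\<^sup>2 * (1 - X / (rho n * dd t n))\<^sup>2"
        by (metis power_mult_distrib)
      have "v * (g * R) / (R * dq * U) = g * (v\<^sup>2 / dq) * (1 / v) * (1 / U)" if "v \<noteq> 0" "R \<noteq> 0" for v g R dq U :: real
        using that by (simp add: power2_eq_square)
      from this[of "vv t n" "(rho n)\<^sup>2"] show ?thesis
        unfolding D2 power_divide power_one using vd s(4) by simp
    qed
    finally show ?case by (simp only: X_def)
  qed
qed

text \<open>Upper and lower Laplace bounds differ only by the factor \<open>?c\<close>, which tends
  to 1.\<close>

lemma excess_asymp: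
  "(\<lambda>n. prefactor t n * integral {xx t n..1} (\<lambda>s. (s - xx t n) * (s ^ P n * (1 - s) ^ (m n - 1)))) \<longlonglongrightarrow> exp (- t)"
proof (rule tendsto_sandwich[OF _ _ _ laplace_main_asymp])
  let ?G = "\<lambda>n. integral {xx t n..1} (\<lambda>s. (s - xx t n) * (s ^ P n * (1 - s) ^ (m n - 1)))"
  let ?err = "\<lambda>n. (real (P n) / (xx t n)\<^sup>2 + 2 * real (m n - 1) / (1 - xx t n)\<^sup>2) * (sqrt (vv t n) / ee t n)\<^sup>2"
  let ?c = "\<lambda>n. exp (- ?err n) * (1 - (1 + sqrt (vv t n)) * exp (- sqrt (vv t n)))"
  \<comment> \<open>The hypotheses of both Laplace bounds with K = sqrt v: a positive decay rate,
    and a window no longer than (1 - x)/2.\<close>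
  have pos: "0 < ee t n" "0 \<le> prefactor t n" "sqrt (vv t n) / ee t n \<le> (1 - xx t n) / 2"
    if n: "P n > 0" "m n > 1" "0 < xx t n" "xx t n < 1" "2 * sqrt (vv t n) + 1 \<le> rho n * dd t n" "1 \<le> vv t n" for n
  proof -
    have pm: "m n > 0" using n by simp
    have "0 \<le> sqrt (vv t n)" using n by simp
    then have D: "0 < rho n * dd t n - xx t n" "2 * sqrt (vv t n) \<le> rho n * dd t n - xx t n" using n by linarith+
    have e: "ee t n = (rho n * dd t n - xx t n) / (xx t n * (1 - xx t n))"
      by (rule ee_eq[OF n(1) pm n(3,4)])
    show "0 < ee t n" unfolding e using D n by simp
    show "0 \<le> prefactor t n" unfolding prefactor_def using n by simp
    have "sqrt (vv t n) / ee t n = (1 - xx t n) * (xx t n * (sqrt (vv t n) / (rho n * dd t n - xx t n)))"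
      unfolding e by simp
    also have "\<dots> \<le> (1 - xx t n) * (1 * (1 / 2))"
    proof (intro mult_left_mono mult_mono)
      show "sqrt (vv t n) / (rho n * dd t n - xx t n) \<le> 1 / 2"
        unfolding pos_divide_le_eq[OF D(1)] using D(2) by simp
      show "0 \<le> sqrt (vv t n) / (rho n * dd t n - xx t n)"
        using D(1) \<open>0 \<le> sqrt (vv t n)\<close> by (rule divide_nonneg_pos[rotated])
    qed (use n in auto)
    finally show "sqrt (vv t n) / ee t n \<le> (1 - xx t n) / 2" by simp
  qed
  show "\<forall>\<^sub>F n in sequentially. prefactor t n * ?G n \<le> laplace_main t n"
    using ev_range[of t]
  proof eventually_elim
    case (elim n)
    then show ?case
      unfolding laplace_main_def by (intro mult_left_mono beta_excess_le pos) (auto simp: ee_def)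
  qed
  show "\<forall>\<^sub>F n in sequentially. laplace_main t n * ?c n \<le> prefactor t n * ?G n"
    using ev_range[of t]
  proof eventually_elim
    case (elim n)
    then have "xx t n ^ P n * (1 - xx t n) ^ (m n - 1) / (ee t n)\<^sup>2 * ?c n \<le> ?G n"
      by (intro beta_excess_ge pos) (auto simp: ee_def)
    then have "prefactor t n * (xx t n ^ P n * (1 - xx t n) ^ (m n - 1) / (ee t n)\<^sup>2 * ?c n) \<le> prefactor t n * ?G n"
      using elim by (intro mult_left_mono pos) auto
    then show ?case by (simp only: laplace_main_def mult.assoc)
  qed
  have "((\<lambda>v::real. (1 + sqrt v) * exp (- sqrt v)) \<longlongrightarrow> 0) at_top" by real_asymp
  from filterlim_compose[OF this vv_top] have k: "(\<lambda>n. (1 + sqrt (vv t n)) * exp (- sqrt (vv t n))) \<longlonglongrightarrow> 0" .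
  have "(\<lambda>n. laplace_main t n * ?c n) \<longlonglongrightarrow> exp (- t) * (exp (- 0) * (1 - 0))"
    by (intro tendsto_mult tendsto_exp tendsto_minus tendsto_diff tendsto_const laplace_main_asymp laplace_error k)
  then show "(\<lambda>n. laplace_main t n * ?c n) \<longlonglongrightarrow> exp (- t)" by simp
qed


section \<open>Sum, maximum and product of the tails\<close>

lemma sum_beta_tail_asymp: "(\<lambda>n. \<Sum>k<Suc (P n). beta_tail k (m n - 1) (xx t n)) \<longlonglongrightarrow> exp (- t)"
proof (rule Lim_transform_eventually[OF excess_asymp])
  show "\<forall>\<^sub>F n in sequentially. prefactor t n * integral {xx t n..1} (\<lambda>s. (s - xx t n) * (s ^ P n * (1 - s) ^ (m n - 1)))
      = (\<Sum>k<Suc (P n). beta_tail k (m n - 1) (xx t n))"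
    using ev_range[of t]
  proof eventually_elim
    case (elim n)
    then have "P n + (m n - 1) + 2 = P n + m n + 1" by simp
    then show ?case
      using elim sum_beta_tail[of "xx t n" "m n - 1" "P n"] by (simp only: prefactor_def beta_excess_eq)
  qed
qed

text \<open>The tail at t is compared with the sum at the lower level t - 1, which stays bounded.
  The thresholds differ by at least \<open>rho\<close> / (N * sqrt L), so the factor in
  \<open>beta_tail_le_sum\<close> is at most sqrt L * \<open>kap\<close>, which tends to 0.\<close>

lemma last_beta_tail_asymp: "(\<lambda>n. beta_tail (P n) (m n - 1) (xx t n)) \<longlonglongrightarrow> 0"
proof (rule tendsto_sandwich[OF _ _ tendsto_const])
  let ?S = "\<lambda>n. \<Sum>k<Suc (P n). beta_tail k (m n - 1) (xx (t - 1) n)"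
  show "\<forall>\<^sub>F n in sequentially. 0 \<le> beta_tail (P n) (m n - 1) (xx t n)"
    using ev_range[of t] by eventually_elim (simp add: beta_tail_nonneg)
  show "\<forall>\<^sub>F n in sequentially. beta_tail (P n) (m n - 1) (xx t n) \<le> sqrt (L n) * kap n * ?S n"
    using ev_range[of t] ev_range[of "t - 1"] ev_pos
  proof eventually_elim
    case (elim n)
    then have pm: "P n > 0" "m n > 0" by auto
    note s = scale_identities[OF pm]
    let ?x = "xx t n" and ?x' = "xx (t - 1) n"
    have sL: "sqrt (L n) > 0" using elim by simp
    have v: "vv t n - vv (t - 1) n = 1 / sqrt (L n)"
      by (simp add: vv_def diff_divide_distrib)
    then have "vv (t - 1) n \<le> vv t n" using sL by (simp add: algebra_simps)
    then have "(vv (t - 1) n)\<^sup>2 * kap n / 4 \<le> (vv t n)\<^sup>2 * kap n / 4"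
      using elim s(2) by (intro divide_right_mono mult_right_mono power_mono) auto
    then have d: "1 / sqrt (L n) \<le> dd t n - dd (t - 1) n"
      using v by (simp add: dd_def)
    have "?x - ?x' = real (P n) * kap n / N n * (dd t n - dd (t - 1) n)"
      by (simp add: xx_def algebra_simps add_divide_distrib diff_divide_distrib)
    also have "\<dots> \<ge> rho n / N n * (1 / sqrt (L n))"
      unfolding s(5) using s d by (intro mult_left_mono) auto
    finally have x: "rho n / N n * (1 / sqrt (L n)) \<le> ?x - ?x'" .
    moreover have r: "rho n / N n * (1 / sqrt (L n)) > 0" using s sL by simp
    ultimately have xx': "?x' < ?x" by linarith
    have "(1 - ?x') / ((real (P n) + real (m n - 1) + 2) * (?x - ?x')) \<le> (real (m n) / N n) / (N n * (rho n / N n * (1 / sqrt (L n))))"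
    proof (rule frac_le)
      show "N n * (rho n / N n * (1 / sqrt (L n))) \<le> (real (P n) + real (m n - 1) + 2) * (?x - ?x')"
        using x r s(1) pm by (intro mult_mono) (auto simp: N_def)
    qed (use elim s r in auto)
    also have "\<dots> = sqrt (L n) * kap n"
      unfolding s(7)[symmetric] using s(1,4) sL by simp
    finally have q: "(1 - ?x') / ((real (P n) + real (m n - 1) + 2) * (?x - ?x')) \<le> sqrt (L n) * kap n" .
    have "beta_tail (P n) (m n - 1) ?x \<le> (1 - ?x') / ((real (P n) + real (m n - 1) + 2) * (?x - ?x')) * ?S n"
      using elim xx' by (intro beta_tail_le_sum) auto
    also have "\<dots> \<le> sqrt (L n) * kap n * ?S n"
      using q elim by (intro mult_right_mono sum_nonneg beta_tail_nonneg) auto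
    finally show ?case .
  qed
  have "(\<lambda>n. vv t n * kap n / (vv t n / sqrt (L n))) \<longlonglongrightarrow> 0 / 1"
    by (intro tendsto_divide vv_kap vv_ratio) simp
  then have "(\<lambda>n. vv t n * kap n / (vv t n / sqrt (L n))) \<longlonglongrightarrow> 0" by simp
  then have "(\<lambda>n. sqrt (L n) * kap n) \<longlonglongrightarrow> 0"
    by (rule Lim_transform_eventually) (use vv_ge_1[of t] in \<open>eventually_elim, simp\<close>)
  from tendsto_mult[OF this sum_beta_tail_asymp[of "t - 1"]]
  show "(\<lambda>n. sqrt (L n) * kap n * ?S n) \<longlonglongrightarrow> 0" by simp
qed

lemma prod_beta_tail_asymp:
  "(\<lambda>n. \<Prod>k<Suc (P n). 1 - beta_tail k (m n - 1) (xx t n)) \<longlonglongrightarrow> exp (- exp (- t))"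
proof (rule tendsto_sandwich)
  let ?S = "\<lambda>n. \<Sum>k<Suc (P n). beta_tail k (m n - 1) (xx t n)"
  let ?e = "\<lambda>n. beta_tail (P n) (m n - 1) (xx t n)"
  have "\<forall>\<^sub>F n in sequentially. ?e n < 1"
    by (rule order_tendstoD[OF last_beta_tail_asymp]) simp
  then have "\<forall>\<^sub>F n in sequentially. exp (- ?S n / (1 - ?e n)) \<le> (\<Prod>k<Suc (P n). 1 - beta_tail k (m n - 1) (xx t n))
     \<and> (\<Prod>k<Suc (P n). 1 - beta_tail k (m n - 1) (xx t n)) \<le> exp (- ?S n)"
    using ev_range[of t]
  proof eventually_elim
    case (elim n)
    have 1: "0 \<le> beta_tail k (m n - 1) (xx t n)" for k
      using elim by (intro beta_tail_nonneg) auto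
    have 2: "beta_tail k (m n - 1) (xx t n) \<le> ?e n" if "k < Suc (P n)" for k
      using elim that by (intro beta_tail_mono) auto
    show ?case
      using prod_one_minus_bounds[of "Suc (P n)" "\<lambda>k. beta_tail k (m n - 1) (xx t n)" "?e n", OF 1 2] elim by blast
  qed
  then show "\<forall>\<^sub>F n in sequentially. exp (- ?S n / (1 - ?e n)) \<le> (\<Prod>k<Suc (P n). 1 - beta_tail k (m n - 1) (xx t n))"
    "\<forall>\<^sub>F n in sequentially. (\<Prod>k<Suc (P n). 1 - beta_tail k (m n - 1) (xx t n)) \<le> exp (- ?S n)"
    by (auto elim: eventually_mono)
  show "(\<lambda>n. exp (- ?S n)) \<longlonglongrightarrow> exp (- exp (- t))"
    by (intro tendsto_exp tendsto_minus sum_beta_tail_asymp)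
  have "(\<lambda>n. exp (- ?S n / (1 - ?e n))) \<longlonglongrightarrow> exp (- exp (- t) / (1 - 0))"
    by (intro tendsto_exp tendsto_minus tendsto_divide tendsto_diff tendsto_const sum_beta_tail_asymp last_beta_tail_asymp) simp
  then show "(\<lambda>n. exp (- ?S n / (1 - ?e n))) \<longlonglongrightarrow> exp (- exp (- t))" by simp
qed

end

section \<open>From the growth conditions and scaling constants to the regime\<close>

text \<open>Both cases provide B \<ge> L and Q \<le> min(P, m) with B^3 / Q tending to 0. For small
  p one has y \<le> 2P, so B = ln(2P) and Q = P work. For p close to n the bound y \<le> n^2 gives B
  = 2 ln n with Q = m, and this is where the cube of ln n is used.\<close>

lemma beta_regime_of_growth:
  fixes p :: "nat \<Rightarrow> nat"
  assumes range: "\<And>n. n \<ge> 2 \<Longrightarrow> 1 \<le> p n \<and> p n < n"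
    and growth: "(filterlim p at_top sequentially \<and> (\<lambda>n. real (p n) / real n) \<longlonglongrightarrow> 0) \<or>
       (filterlim (\<lambda>n. (real n - real (p n)) / (ln (real n)) ^ 3) at_top sequentially \<and>
        (\<lambda>n. (real n - real (p n)) / real n) \<longlonglongrightarrow> 0)"
  shows "beta_regime (\<lambda>n. p n - 1) (\<lambda>n. n - p n)"
proof -
  define P where "P n = p n - 1" for n
  define m where "m n = n - p n" for n
  define L where "L n = ln ((real (P n) + real (m n) + 1) * real (P n) / real (m n))" for n
  have range': "\<forall>\<^sub>F n in sequentially. 2 \<le> n \<and> real (P n) = real (p n) - 1 \<and> real (m n) = real n - real (p n) \<and> 1 \<le> real (m n)"
    using eventually_ge_at_top[of 2]
  proof eventually_elim
    case (elim n)
    from range[OF elim] elim show ?case by (auto simp: P_def m_def)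
  qed
  have nn: "filterlim (\<lambda>n. real n) at_top sequentially"
    by (rule filterlim_real_sequentially)
  have ln3: "((\<lambda>x::real. ln (2 * x) ^ 3 / x) \<longlongrightarrow> 0) at_top" by real_asymp
  consider (small) "filterlim p at_top sequentially" "(\<lambda>n. real (p n) / real n) \<longlonglongrightarrow> 0"
    | (large) "filterlim (\<lambda>n. (real n - real (p n)) / (ln (real n)) ^ 3) at_top sequentially"
       "(\<lambda>n. (real n - real (p n)) / real n) \<longlonglongrightarrow> 0"
    using growth by blast
  then have main: "filterlim (\<lambda>n. real (P n)) at_top sequentially \<and> filterlim (\<lambda>n. real (m n)) at_top sequentially
    \<and> (\<exists>B Q. (\<lambda>n. B n ^ 3 / Q n) \<longlonglongrightarrow> 0
       \<and> (\<forall>\<^sub>F n in sequentially. 0 < Q n \<and> Q n \<le> real (P n) \<and> Q n \<le> real (m n) \<and> L n \<le> B n))"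
  proof cases
    case small
    have p: "filterlim (\<lambda>n. real (p n)) at_top sequentially"
      by (rule filterlim_compose[OF filterlim_real_sequentially small(1)])
    have "filterlim (\<lambda>n. - 1 + real (p n)) at_top sequentially"
      by (rule filterlim_tendsto_add_at_top[OF tendsto_const p])
    then have P: "filterlim (\<lambda>n. real (P n)) at_top sequentially"
      by (rule filterlim_at_top_mono) (use range' in \<open>eventually_elim, simp\<close>)
    \<comment> \<open>The bound 1/2 makes n \<le> 2m, hence y = n P / m \<le> 2P, and P \<le>
      m.\<close>
    have "\<forall>\<^sub>F n in sequentially. real (p n) / real n < 1 / 2"
      by (rule order_tendstoD[OF small(2)]) simp
    then have half: "\<forall>\<^sub>F n in sequentially. real n \<le> 2 * real (m n) \<and> real (P n) \<le> real (m n)"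
      using range' by eventually_elim (auto simp: field_simps)
    have m: "filterlim (\<lambda>n. real (m n)) at_top sequentially"
      by (rule filterlim_at_top_mono[OF P]) (use half in \<open>eventually_elim, simp\<close>)
    have "(\<lambda>n. ln (2 * real (P n)) ^ 3 / real (P n)) \<longlonglongrightarrow> 0"
      by (rule filterlim_compose[OF ln3 P])
    moreover have "\<forall>\<^sub>F n in sequentially. real (P n) > 0"
      using P[unfolded filterlim_at_top_dense] by blast
    then have "\<forall>\<^sub>F n in sequentially. 0 < real (P n) \<and> real (P n) \<le> real (P n) \<and> real (P n) \<le> real (m n) \<and> L n \<le> ln (2 * real (P n))"
      using half range'
    proof eventually_elim
      case (elim n)
      then have "(real (P n) + real (m n) + 1) * real (P n) / real (m n) \<le> 2 * real (m n) * real (P n) / real (m n)"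
        by (intro divide_right_mono mult_right_mono) auto
      also have "\<dots> = 2 * real (P n)"
      proof -
        have "real (m n) \<noteq> 0" using elim by linarith
        then show ?thesis by simp
      qed
      finally have "(real (P n) + real (m n) + 1) * real (P n) / real (m n) \<le> 2 * real (P n)" .
      then show ?case using elim by (simp add: L_def)
    qed
    ultimately show ?thesis using P m
      by - (intro conjI exI[of _ "\<lambda>n. ln (2 * real (P n))"] exI[of _ "\<lambda>n. real (P n)"]; assumption)
  next
    case large
    have "filterlim (\<lambda>n. ln (real n) ^ 3) at_top sequentially" by real_asymp
    from filterlim_at_top_mult_at_top[OF large(1) this]
    have m: "filterlim (\<lambda>n. real (m n)) at_top sequentially"
    proof (rule filterlim_at_top_mono)
      show "\<forall>\<^sub>F n in sequentially. (real n - real (p n)) / ln (real n) ^ 3 * ln (real n) ^ 3 \<le> real (m n)"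
        using range' by eventually_elim simp
    qed
    \<comment> \<open>The margin 1/4 absorbs the -1 in P = p - 1: for n \<ge> 4 it still gives P
      \<ge> n/2, hence m \<le> P.\<close>
    have "\<forall>\<^sub>F n in sequentially. (real n - real (p n)) / real n < 1 / 4"
      by (rule order_tendstoD[OF large(2)]) simp
    then have half: "\<forall>\<^sub>F n in sequentially. real (m n) \<le> real n / 4 \<and> real n / 2 \<le> real (P n) \<and> real (P n) \<le> real n"
      using range' eventually_ge_at_top[of 4] by eventually_elim (auto simp: field_simps)
    have "filterlim (\<lambda>n. real n / 2) at_top sequentially" by real_asymp
    then have P: "filterlim (\<lambda>n. real (P n)) at_top sequentially"
      by (rule filterlim_at_top_mono) (use half in \<open>eventually_elim, simp\<close>)
    have "(\<lambda>n. 8 * inverse ((real n - real (p n)) / (ln (real n)) ^ 3)) \<longlonglongrightarrow> 8 * 0"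
      by (intro tendsto_mult tendsto_const tendsto_inverse_0_at_top large(1))
    then have "(\<lambda>n. 8 * inverse ((real n - real (p n)) / (ln (real n)) ^ 3)) \<longlonglongrightarrow> 0" by simp
    then have "(\<lambda>n. (2 * ln (real n)) ^ 3 / real (m n)) \<longlonglongrightarrow> 0"
      by (rule Lim_transform_eventually)
        (use range' in \<open>eventually_elim, simp add: power_mult_distrib\<close>)
    moreover have "\<forall>\<^sub>F n in sequentially. 0 < real (m n) \<and> real (m n) \<le> real (P n) \<and> real (m n) \<le> real (m n) \<and> L n \<le> 2 * ln (real n)"
      using half range'
    proof eventually_elim
      case (elim n)
      have "(real (P n) + real (m n) + 1) * real (P n) / real (m n) \<le> real n * real n / 1"
        using elim by (intro frac_le mult_mono) auto
      moreover have "0 < (real (P n) + real (m n) + 1) * real (P n) / real (m n)"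
        using elim by (intro divide_pos_pos mult_pos_pos) auto
      ultimately have "L n \<le> ln (real n * real n)"
        unfolding L_def using elim by (subst ln_le_cancel_iff) auto
      also have "\<dots> = 2 * ln (real n)" using elim by (simp add: ln_mult)
      finally show ?case using elim by auto
    qed
    ultimately show ?thesis using P m
      by - (intro conjI exI[of _ "\<lambda>n. 2 * ln (real n)"] exI[of _ "\<lambda>n. real (m n)"]; assumption)
  qed
  then have P: "filterlim (\<lambda>n. real (P n)) at_top sequentially" and m: "filterlim (\<lambda>n. real (m n)) at_top sequentially"
    by blast+
  from main obtain B Q where BQ: "(\<lambda>n. B n ^ 3 / Q n) \<longlonglongrightarrow> 0"
    "\<forall>\<^sub>F n in sequentially. 0 < Q n \<and> Q n \<le> real (P n) \<and> Q n \<le> real (m n) \<and> L n \<le> B n" by blast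
  have Ppos: "\<forall>\<^sub>F n in sequentially. real (P n) > 0"
    using P[unfolded filterlim_at_top_dense] by blast
  have L: "filterlim L at_top sequentially"
  proof (rule filterlim_at_top_mono[OF filterlim_compose[OF ln_at_top P]])
    show "\<forall>\<^sub>F n in sequentially. ln (real (P n)) \<le> L n"
      using range' Ppos
    proof eventually_elim
      case (elim n)
      then have "real (P n) \<le> (real (P n) + real (m n) + 1) * real (P n) / real (m n)"
        by (simp add: le_divide_eq algebra_simps)
      then show ?case unfolding L_def using elim by (subst ln_le_cancel_iff) auto
    qed
  qed
  have Lpos: "\<forall>\<^sub>F n in sequentially. L n > 0"
    using L by (simp add: filterlim_at_top_dense)
  have cube: "(\<lambda>n. L n ^ 3 / R n) \<longlonglongrightarrow> 0" if "\<forall>\<^sub>F n in sequentially. Q n \<le> R n" for R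
  proof (rule tendsto_sandwich[OF _ _ tendsto_const BQ(1)])
    show "\<forall>\<^sub>F n in sequentially. 0 \<le> L n ^ 3 / R n"
      using Lpos BQ(2) that by eventually_elim auto
    show "\<forall>\<^sub>F n in sequentially. L n ^ 3 / R n \<le> B n ^ 3 / Q n"
      using Lpos BQ(2) that by eventually_elim (intro frac_le power_mono, auto)
  qed
  have "filterlim P at_top sequentially" "filterlim m at_top sequentially"
    using P[unfolded filterlim_at_top, rule_format, of "real _"] m[unfolded filterlim_at_top, rule_format, of "real _"]
    by (simp_all add: filterlim_at_top)
  moreover have "(\<lambda>n. L n ^ 3 / real (P n)) \<longlonglongrightarrow> 0" "(\<lambda>n. L n ^ 3 / real (m n)) \<longlonglongrightarrow> 0"
    using BQ(2) by (intro cube; eventually_elim; simp)+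
  ultimately have "beta_regime P m"
    using L unfolding beta_regime_def L_def by simp
  then show ?thesis by (simp add: P_def[abs_def] m_def[abs_def])
qed

text \<open>Squaring A + B t = sqrt(P/N) + h v gives P/N * (1 + (v + v^2 \<open>kap\<close> / 4)
  \<open>kap\<close>); the quadratic term of \<open>dd\<close> is exactly the square of the
  deviation h v.\<close>

lemma scaling_sequences:
  fixes p :: "nat \<Rightarrow> nat"
  assumes regime: "beta_regime (\<lambda>n. p n - 1) (\<lambda>n. n - p n)"
    and range: "\<And>n. n \<ge> 2 \<Longrightarrow> 1 \<le> p n \<and> p n < n"
  shows "\<forall>\<^sub>F n in sequentially. 0 < B_seq p n \<and> 0 \<le> A_seq p n + B_seq p n * t \<and> A_seq p n + B_seq p n * t \<le> 1
    \<and> (A_seq p n + B_seq p n * t)\<^sup>2 = beta_regime.xx (\<lambda>n. p n - 1) (\<lambda>n. n - p n) t n"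
proof -
  interpret beta_regime "\<lambda>n. p n - 1" "\<lambda>n. n - p n" "\<lambda>n. real (p n - 1) + real (n - p n)"
    "\<lambda>n. (real (p n - 1) + real (n - p n) + 1) * real (p n - 1) / real (n - p n)"
    "\<lambda>n. ln ((real (p n - 1) + real (n - p n) + 1) * real (p n - 1) / real (n - p n))"
    by (fact regime)
  show ?thesis
    using ev_range[of t] ev_pos eventually_ge_at_top[of 2]
  proof eventually_elim
    case (elim n)
    define P where "P = real (p n - 1)"
    define m where "m = real (n - p n)"
    define N where "N = P + m"
    define l where "l = ln ((N + 1) * P / m)"
    define v where "v = vv t n"
    have "p n - 1 > 0" "n - p n > 0" using elim by linarith+
    then have pos: "P > 0" "m > 0" "N > 0" "l > 1" "v \<ge> 1" using elim by (simp_all add: P_def m_def N_def l_def v_def)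
    have Pp: "real (p n) - 1 = P" and Nn: "real n - 1 = N"
      using range[OF elim(3)] elim(3) by (simp_all add: P_def m_def N_def of_nat_diff)
    have n: "real n = N + 1" using Nn by simp
    have c: "c_seq p n = sqrt (P / N)" "(c_seq p n)\<^sup>2 = P / N"
      using pos by (simp_all add: c_seq_def Pp Nn)
    have c1: "1 - (c_seq p n)\<^sup>2 = m / N"
      unfolding c(2) using pos by (simp add: N_def field_simps)
    have y: "y_seq p n = (N + 1) * P / m"
      unfolding y_seq_def c1 unfolding c(2) n using pos by simp
    have pw: "u powr (1 / 2) = sqrt u" "u powr (- 1 / 2) = 1 / sqrt u" if "u > 0" for u :: real
      using that by (simp_all add: powr_half_sqrt powr_minus_divide)
    have v: "a_fun (y_seq p n) + b_fun (y_seq p n) * t = v"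
    proof -
      have "v = sqrt l - ln (sqrt (2 * pi) * l) / sqrt l + t / sqrt l"
        unfolding v_def vv_def l_def N_def P_def m_def by (rule refl)
      moreover have "l > 0" using pos by simp
      ultimately show ?thesis
        unfolding a_fun_def b_fun_def y l_def[symmetric] by (simp only: pw) simp
    qed
    define h where "h = 1 / 2 * sqrt (m / N) * (1 / sqrt N)"
    have h: "h > 0" using pos by (simp add: h_def)
    have A: "A_seq p n = sqrt (P / N) + h * a_fun (y_seq p n)" and B: "B_seq p n = h * b_fun (y_seq p n)"
      unfolding A_seq_def B_seq_def c1 Nn unfolding c(1) h_def pw(2)[OF pos(3)] by simp_all
    have AB: "A_seq p n + B_seq p n * t = sqrt (P / N) + h * v"
      unfolding A B v[symmetric] by (simp add: algebra_simps)
    have "B_seq p n > 0"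
      unfolding B b_fun_def y l_def[symmetric] using h pos by simp
    moreover have nonneg: "0 \<le> A_seq p n + B_seq p n * t"
      unfolding AB using pos h by simp
    moreover have sq: "(A_seq p n + B_seq p n * t)\<^sup>2 = xx t n"
    proof -
      define k where "k = sqrt (m / (P * N))"
      have k: "kap n = k" unfolding kap_def k_def N_def P_def m_def by (rule refl)
      have k2: "k\<^sup>2 = m / (P * N)" using pos by (simp add: k_def)
      have "h\<^sup>2 = P / N * k\<^sup>2 / 4"
        unfolding k2 h_def power_mult_distrib power_divide using pos by (simp add: power2_eq_square)
      moreover have "2 * sqrt (P / N) * h = P / N * k"
      proof -
        have "sqrt (P / N) * (sqrt (m / N) * (1 / sqrt N)) = P / N * k"
        proof (rule power2_eq_imp_eq)
          have sq: "(sqrt (P / N))\<^sup>2 = P / N" "(sqrt (m / N))\<^sup>2 = m / N" "(1 / sqrt N)\<^sup>2 = 1 / N"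
            using pos by (simp_all add: power_divide)
          show "(sqrt (P / N) * (sqrt (m / N) * (1 / sqrt N)))\<^sup>2 = (P / N * k)\<^sup>2"
            unfolding power_mult_distrib sq k2 using pos by (simp add: power2_eq_square)
          have "0 \<le> k" unfolding k_def using pos by simp
          then show "0 \<le> P / N * k" using pos by simp
          show "0 \<le> sqrt (P / N) * (sqrt (m / N) * (1 / sqrt N))" using pos by simp
        qed
        moreover have "2 * sqrt (P / N) * h = sqrt (P / N) * (sqrt (m / N) * (1 / sqrt N))"
          by (simp add: h_def)
        ultimately show ?thesis by (simp only:)
      qed
      moreover have "(sqrt (P / N) + h * v)\<^sup>2 = P / N + 2 * sqrt (P / N) * h * v + h\<^sup>2 * v\<^sup>2"
        using pos by (simp add: power2_sum power_mult_distrib)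
      ultimately have "(sqrt (P / N) + h * v)\<^sup>2 = P / N + P / N * k * v + P / N * k\<^sup>2 / 4 * v\<^sup>2"
        by (simp only:)
      also have "\<dots> = P / N * (1 + (v + v\<^sup>2 * k / 4) * k)"
        by (simp add: algebra_simps power2_eq_square)
      also have "\<dots> = xx t n"
        unfolding xx_def dd_def k v_def N_def P_def m_def by (rule refl)
      finally show ?thesis by (simp only: AB)
    qed
    \<comment> \<open>The product formula for the probability is stated for levels in [0, 1], so the
      threshold must not exceed 1.\<close>
    moreover have "A_seq p n + B_seq p n * t \<le> 1"
    proof (rule power2_le_imp_le)
      have "xx t n < 1" using elim by blast
      then show "(A_seq p n + B_seq p n * t)\<^sup>2 \<le> 1\<^sup>2" unfolding sq by simp
    qed simp
    ultimately show ?case by blast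
  qed
qed

theorem theorem2:
  fixes p :: "nat \<Rightarrow> nat"
    and M :: "nat \<Rightarrow> 'a measure"
    and U :: "nat \<Rightarrow> 'a \<Rightarrow> complex mat"
    and z :: "nat \<Rightarrow> nat \<Rightarrow> 'a \<Rightarrow> complex"
    and C :: "nat \<Rightarrow> real"
  assumes p_range: "\<And>n. n \<ge> 2 \<Longrightarrow> 1 \<le> p n \<and> p n < n"
    and prob: "\<And>n. n \<ge> 2 \<Longrightarrow> prob_space (M n)"
    and haar: "\<And>n. n \<ge> 2 \<Longrightarrow> haar_unitary_rv (M n) n (U n)"
    and z_measurable: "\<And>n j. n \<ge> 2 \<Longrightarrow> j \<in> {1..p n} \<Longrightarrow> z n j \<in> borel_measurable (M n)"
    and z_eigenvalues: "\<And>n. n \<ge> 2 \<Longrightarrow>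
          (AE \<omega> in M n. eigenvalues_of (truncation (p n) (U n \<omega>)) {1..p n} (\<lambda>j. z n j \<omega>))"
    and z_density: "\<And>n. n \<ge> 2 \<Longrightarrow>
          unordered_joint_density (M n) {1..p n} (z n) (truncated_unitary_density (C n) n (p n))"
    and growth:
      "(filterlim p at_top sequentially \<and> (\<lambda>n. real (p n) / real n) \<longlonglongrightarrow> 0) \<or>
       (filterlim (\<lambda>n. (real n - real (p n)) / (ln (real n)) ^ 3) at_top sequentially \<and>
        (\<lambda>n. (real n - real (p n)) / real n) \<longlonglongrightarrow> 0)"
  shows "weak_conv
           (\<lambda>n. cdf (distr (M n) borel
                  (\<lambda>\<omega>. ((MAX j\<in>{1..p n}. cmod (z n j \<omega>)) - A_seq p n) / B_seq p n)))
           gumbel_cdf"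
  unfolding weak_conv_def
proof (intro allI impI)
  fix t :: real
  have regime: "beta_regime (\<lambda>n. p n - 1) (\<lambda>n. n - p n)"
    by (rule beta_regime_of_growth[OF _ growth]) (rule p_range)
  have scaling: "\<forall>\<^sub>F n in sequentially. 0 < B_seq p n \<and> 0 \<le> A_seq p n + B_seq p n * t \<and> A_seq p n + B_seq p n * t \<le> 1
    \<and> (A_seq p n + B_seq p n * t)\<^sup>2 = beta_regime.xx (\<lambda>n. p n - 1) (\<lambda>n. n - p n) t n"
    by (rule scaling_sequences[OF regime]) (rule p_range)
  let ?X = "\<lambda>n \<omega>. ((MAX j\<in>{1..p n}. cmod (z n j \<omega>)) - A_seq p n) / B_seq p n"
  let ?x = "beta_regime.xx (\<lambda>n. p n - 1) (\<lambda>n. n - p n) t"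
  have "(\<lambda>n. \<Prod>k<Suc (p n - 1). 1 - beta_tail k (n - p n - 1) (?x n)) \<longlonglongrightarrow> gumbel_cdf t"
    unfolding gumbel_cdf_def by (rule beta_regime.prod_beta_tail_asymp[OF regime])
  then show "(\<lambda>n. cdf (distr (M n) borel (?X n)) t) \<longlonglongrightarrow> gumbel_cdf t"
  proof (rule Lim_transform_eventually)
    \<comment> \<open>For large n the distribution function at t is the finite product itself;
      positivity of B turns the rescaled event into the event that all moduli are at most A + B
      t.\<close>
    show "\<forall>\<^sub>F n in sequentially. (\<Prod>k<Suc (p n - 1). 1 - beta_tail k (n - p n - 1) (?x n)) = cdf (distr (M n) borel (?X n)) t"
      using scaling eventually_ge_at_top[of 2]
    proof eventually_elim
      case (elim n)
      let ?r = "A_seq p n + B_seq p n * t"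
      have p: "1 \<le> p n" using p_range elim by blast
      then have ne: "(\<lambda>j. cmod (z n j \<omega>)) ` {1..p n} \<noteq> {}" for \<omega> by simp
      have "(\<lambda>\<omega>. MAX j\<in>{1..p n}. cmod (z n j \<omega>)) \<in> borel_measurable (M n)"
        using p z_measurable[OF elim(2)] by (intro borel_measurable_Max borel_measurable_norm) auto
      then have X: "?X n \<in> borel_measurable (M n)" by measurable
      have "?X n \<omega> \<le> t \<longleftrightarrow> (\<forall>j\<in>{1..p n}. cmod (z n j \<omega>) \<le> ?r)" for \<omega>
      proof -
        have "?X n \<omega> \<le> t \<longleftrightarrow> (MAX j\<in>{1..p n}. cmod (z n j \<omega>)) \<le> ?r"
          using elim by (auto simp: divide_le_eq algebra_simps)
        also have "\<dots> \<longleftrightarrow> (\<forall>j\<in>{1..p n}. cmod (z n j \<omega>) \<le> ?r)"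
          using ne by (subst Max_le_iff) auto
        finally show ?thesis .
      qed
      then have "?X n -` {..t} \<inter> space (M n) = {\<omega>\<in>space (M n). \<forall>j\<in>{1..p n}. cmod (z n j \<omega>) \<le> ?r}"
        by auto
      then have "cdf (distr (M n) borel (?X n)) t = measure (M n) {\<omega>\<in>space (M n). \<forall>j\<in>{1..p n}. cmod (z n j \<omega>) \<le> ?r}"
        unfolding cdf_def using X by (simp add: measure_distr)
      also have "\<dots> = (\<Prod>k<p n. 1 - beta_tail k (n - p n - 1) (?r\<^sup>2))"
        using prob_all_eigenvalues_le[OF prob z_density] elim by blast
      \<comment> \<open>The regime is indexed by P = p - 1; since p \<ge> 1, its P + 1 factors are
        the p factors of the product formula.\<close>
      also have "\<dots> = (\<Prod>k<Suc (p n - 1). 1 - beta_tail k (n - p n - 1) (?x n))"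
        using elim p by simp
      finally show ?case ..
    qed
  qed
qed

end
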